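(* Let $n\ge 1$ and $m\ge 0$ be integers and let $T$ be a triangulation of the annulus $A_{n,m}$ with (outer) quiddity sequence $(a_1,\dots,a_n)$. Then $(a_1,\dots,a_n)$ defines a periodic infinite frieze; that is, the $n$-periodic extension $(a_i)_{i\in\mathbb{Z}}$ of $(a_1,\dots,a_n)$ is the quiddity row of an infinite frieze.
   Context: Friezes. An infinite frieze (of positive integers) is an array $(m_{ij})_{i,j\in\mathbb{Z},\,j\ge i-2}$ such that $m_{i,i-2}=0$, $m_{i,i-1}=1$ for all $i$, $m_{ij}\in\mathbb{Z}_{>0}$ for all $i\le j$, and $m_{ij}m_{i+1,j+1}-m_{i+1,j}m_{i,j+1}=1$ for all $i,j$ with $j\ge i-1$. Its quiddity row is $(a_i)_{i\in\mathbb{Z}}$, $a_i=m_{ii}$. Annuli and arcs. For integers $n\ge 1$, $m\ge 0$, $A_{n,m}$ is an annulus with $n$ marked points $1,\dots,n$ on the outer boundary (in cyclic order) and $m$ marked points $n+1,\dots,n+m$ on the inner boundary. A finite arc is a non-contractible curve whose endpoints are marked points, without self-intersections (except that its endpoints may coincide), considered up to isotopy fixing endpoints; boundary segments (between neighbouring marked points) are not arcs. A finite arc is peripheral if both endpoints lie on the same boundary component, and bridging otherwise. Let $z$ (the meridian) be a non-contractible closed curve in the interior of $A_{n,m}$. An asymptotic arc is a curve (without self-intersections, up to isotopy fixing its endpoint) having one endpoint at a marked point and winding infinitely around $z$; it is a Prüfer arc if it spirals around $z$ positively and an adic arc otherwise. The arcs of $A_{n,m}$ are the finite arcs and the asymptotic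 arcs. Two arcs are compatible if there are representatives in their isotopy classes that do not intersect (except at endpoints). A triangulation of $A_{n,m}$ is a maximal collection of pairwise compatible arcs. Quiddity sequence of a triangulation. The universal cover $\pi:\mathbb{U}\to A_{n,m}$ is an infinite strip of height $1$ in $\mathbb{R}^2$ whose lower boundary covers the outer boundary. If $m>0$ its marked points are $(km,0)$ and $(kn,1)$, $k\in\mathbb{Z}$, and $\pi(r+knm,0)=r/m+1$, $\pi(s+knm,1)=s/n+n+1$ for $0\le r,s<nm$ and $k\in\mathbb{Z}$; if $m=0$ its marked points are $(k,0)$, $k\in\mathbb{Z}$, and $\pi(t+kn,0)=t+1$ for $0\le t<n$. For a triangulation $T$, $\pi^{-1}(T)$ is a triangulation of $\mathbb{U}$ (lifts of asymptotic arcs run to infinity, and regions bounded by two of them count as triangles with a vertex at infinity). The (outer) quiddity sequence of $T$ is $(a_1,\dots,a_n)$, where $a_i$ is the number of triangles of $\pi^{-1}(T)$ incident with $((i-1)m,0)$ if $m>0$, and with $(i-1,0)$ if $m=0$. Equivalently, $a_i$ is one more than the number of ends of arcs of $T$ at the marked point $i$. *)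

theory Defs
  imports "HOL-Analysis.Analysis"
begin

section \<open>Infinite friezes\<close>

text \<open>Only the entries \<open>F i j\<close> with \<open>j \<ge> i - 2\<close> are meaningful.\<close>

definition infinite_frieze :: "(int \<Rightarrow> int \<Rightarrow> int) \<Rightarrow> bool" where
  "infinite_frieze F \<longleftrightarrow>
     (\<forall>i. F i (i - 2) = 0) \<and>
     (\<forall>i. F i (i - 1) = 1) \<and>
     (\<forall>i j. i \<le> j \<longrightarrow> F i j > 0) \<and>
     (\<forall>i j. j \<ge> i - 1 \<longrightarrow> F i j * F (i + 1) (j + 1) - F (i + 1) j * F i (j + 1) = 1)"

definition quiddity_row :: "(int \<Rightarrow> int \<Rightarrow> int) \<Rightarrow> int \<Rightarrow> int" where
  "quiddity_row F i = F i i"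

definition periodic_extension :: "nat \<Rightarrow> (nat \<Rightarrow> nat) \<Rightarrow> int \<Rightarrow> int" where
  "periodic_extension n a i = int (a (nat ((i - 1) mod int n) + 1))"


section \<open>The annulus and its marked points\<close>

text \<open>
  The covering of the annulus by the strip of height 1 is
  \<open>(x, y) \<mapsto> (2 - y) * cis (2 * pi * x / (n * m))\<close> (with \<open>n * m\<close> replaced by \<open>n\<close> if \<open>m = 0\<close>),
  so the lower boundary of the strip covers the outer boundary.
\<close>

definition annulus :: "complex set" where
  "annulus = {w. 1 \<le> norm w \<and> norm w \<le> 2}"

definition meridian :: "complex set" where
  "meridian = sphere 0 (3 / 2)"

definition marked_point :: "nat \<Rightarrow> nat \<Rightarrow> nat \<Rightarrow> complex" where
  "marked_point n m k =
     (if k \<le> n then 2 * cis (2 * pi * (real k - 1) / real n)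
      else cis (2 * pi * (real k - real n - 1) / real m))"

definition marked_points :: "nat \<Rightarrow> nat \<Rightarrow> complex set" where
  "marked_points n m = marked_point n m ` {1..n + m}"

definition boundary_segments :: "nat \<Rightarrow> nat \<Rightarrow> (real \<Rightarrow> complex) set" where
  "boundary_segments n m =
     {\<lambda>t. 2 * cis (2 * pi * (real k - 1 + t) / real n) | k. k \<in> {1..n}} \<union>
     {\<lambda>t. cis (2 * pi * (real k - 1 + t) / real m) | k. k \<in> {1..m}}"


section \<open>Finite arcs\<close>

text \<open>
  An isotopy of paths fixing the endpoints. Intermediate paths may touch the boundary, so that
  a curve can be isotopic to a boundary segment. Note that \<^const>\<open>simple_path\<close> allows the two
  endpoints to coincide.
\<close>

definition isotopic_paths :: "(real \<Rightarrow> complex) \<Rightarrow> (real \<Rightarrow> complex) \<Rightarrow> bool" where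
  "isotopic_paths g h \<longleftrightarrow>
     homotopic_with_canon
       (\<lambda>f. simple_path f \<and> pathstart f = pathstart g \<and> pathfinish f = pathfinish g)
       {0..1} annulus g h"

text \<open>Arcs are unoriented.\<close>

definition isotopic_curves :: "(real \<Rightarrow> complex) \<Rightarrow> (real \<Rightarrow> complex) \<Rightarrow> bool" where
  "isotopic_curves g h \<longleftrightarrow> isotopic_paths g h \<or> isotopic_paths g (reversepath h)"

definition finite_curve :: "nat \<Rightarrow> nat \<Rightarrow> (real \<Rightarrow> complex) \<Rightarrow> bool" where
  "finite_curve n m g \<longleftrightarrow>
     simple_path g \<and>
     pathstart g \<in> marked_points n m \<and> pathfinish g \<in> marked_points n m \<and>
     g ` {0<..<1} \<subseteq> interior annulus \<and>
     \<not> homotopic_paths annulus g (linepath (pathstart g) (pathstart g)) \<and>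
     (\<forall>s \<in> boundary_segments n m. \<not> isotopic_curves g s)"


section \<open>Asymptotic arcs\<close>

text \<open>
  Asymptotic curves are parametrised by \<open>{0..}\<close>. They approach the meridian from the side on
  which they start. The filter \<open>D\<close> is the direction of the winding:
  \<^const>\<open>at_top\<close> for Pruefer curves and \<^const>\<open>at_bot\<close> for adic curves.
\<close>

definition asymptotic_curve ::
    "nat \<Rightarrow> nat \<Rightarrow> real filter \<Rightarrow> (real \<Rightarrow> complex) \<Rightarrow> bool" where
  "asymptotic_curve n m D g \<longleftrightarrow>
     continuous_on {0..} g \<and> inj_on g {0..} \<and>
     g 0 \<in> marked_points n m \<and>
     g ` {0<..} \<subseteq> interior annulus - meridian \<and>
     ((\<lambda>t. infdist (g t) meridian) \<longlongrightarrow> 0) at_top \<and>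
     (\<exists>\<theta>. continuous_on {0..} \<theta> \<and>
          (\<forall>t\<ge>0. g t = of_real (norm (g t)) * cis (\<theta> t)) \<and>
          filterlim \<theta> D at_top)"

text \<open>
  The intermediate curves must all wind in the direction \<open>D\<close>: since \<open>{0..}\<close> is not compact, a
  homotopy that is merely continuous could otherwise push a change of direction off to infinity.
\<close>

definition isotopic_asymptotic ::
    "nat \<Rightarrow> nat \<Rightarrow> real filter \<Rightarrow> (real \<Rightarrow> complex) \<Rightarrow> (real \<Rightarrow> complex) \<Rightarrow> bool" where
  "isotopic_asymptotic n m D g h \<longleftrightarrow>
     homotopic_with_canon (\<lambda>f. asymptotic_curve n m D f \<and> f 0 = g 0) {0..} annulus g h"


section \<open>Arcs and triangulations\<close>

text \<open>An arc is the set of all its representatives.\<close>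

datatype annulus_arc =
    Finite_arc "(real \<Rightarrow> complex) set"
  | Asymptotic_arc "(real \<Rightarrow> complex) set"

definition finite_arcs :: "nat \<Rightarrow> nat \<Rightarrow> annulus_arc set" where
  "finite_arcs n m =
     {Finite_arc {h. finite_curve n m h \<and> isotopic_curves g h} | g. finite_curve n m g}"

definition spiralling_arcs :: "nat \<Rightarrow> nat \<Rightarrow> real filter \<Rightarrow> annulus_arc set" where
  "spiralling_arcs n m D =
     {Asymptotic_arc {h. isotopic_asymptotic n m D g h} | g. asymptotic_curve n m D g}"

definition pruefer_arcs :: "nat \<Rightarrow> nat \<Rightarrow> annulus_arc set" where
  "pruefer_arcs n m = spiralling_arcs n m at_top"

definition adic_arcs :: "nat \<Rightarrow> nat \<Rightarrow> annulus_arc set" where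
  "adic_arcs n m = spiralling_arcs n m at_bot"

definition arcs :: "nat \<Rightarrow> nat \<Rightarrow> annulus_arc set" where
  "arcs n m = finite_arcs n m \<union> pruefer_arcs n m \<union> adic_arcs n m"

fun traces :: "annulus_arc \<Rightarrow> complex set set" where
  "traces (Finite_arc C) = path_image ` C"
| "traces (Asymptotic_arc C) = (\<lambda>g. g ` {0..}) ` C"

text \<open>
  The marked points on a representative of an arc are exactly its endpoints, because all its
  other points are interior to the annulus.
\<close>

definition compatible :: "nat \<Rightarrow> nat \<Rightarrow> annulus_arc \<Rightarrow> annulus_arc \<Rightarrow> bool" where
  "compatible n m \<alpha> \<beta> \<longleftrightarrow>
     (\<exists>X \<in> traces \<alpha>. \<exists>Y \<in> traces \<beta>. X \<inter> Y \<subseteq> marked_points n m)"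

definition annulus_triangulation :: "nat \<Rightarrow> nat \<Rightarrow> annulus_arc set \<Rightarrow> bool" where
  "annulus_triangulation n m T \<longleftrightarrow>
     T \<subseteq> arcs n m \<and> pairwise (compatible n m) T \<and>
     (\<forall>T'. T \<subseteq> T' \<and> T' \<subseteq> arcs n m \<and> pairwise (compatible n m) T' \<longrightarrow> T' = T)"


section \<open>Quiddity sequences\<close>

text \<open>A loop based at \<open>p\<close> has two ends at \<open>p\<close>.\<close>

fun num_ends :: "complex \<Rightarrow> annulus_arc \<Rightarrow> nat" where
  "num_ends p (Finite_arc C) =
     (if \<exists>g\<in>C. pathstart g = p \<and> pathfinish g = p then 2
      else if \<exists>g\<in>C. pathstart g = p \<or> pathfinish g = p then 1 else 0)"
| "num_ends p (Asymptotic_arc C) = (if \<exists>g\<in>C. g 0 = p then 1 else 0)"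

text \<open>
  The triangles of the lifted triangulation at a lift of the marked point \<open>i\<close> are separated by
  the ends of arcs at \<open>i\<close>, so their number is one more than the number of these ends.
  Finiteness is stated because a sum over an infinite set is 0 by convention.
\<close>

definition outer_quiddity_sequence ::
    "nat \<Rightarrow> nat \<Rightarrow> annulus_arc set \<Rightarrow> (nat \<Rightarrow> nat) \<Rightarrow> bool" where
  "outer_quiddity_sequence n m T a \<longleftrightarrow>
     (\<forall>i \<in> {1..n}.
        let S = {\<alpha> \<in> T. num_ends (marked_point n m i) \<alpha> \<noteq> 0}
        in finite S \<and> a i = 1 + (\<Sum>\<alpha>\<in>S. num_ends (marked_point n m i) \<alpha>))"

end

theory Submission
  imports Defs "HOL-Complex_Analysis.Winding_Numbers" "HOL-Real_Asymp.Real_Asymp"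
begin

text \<open>
  A sequence \<open>a\<close> is the quiddity row of an infinite frieze as soon as there is a positive \<open>v\<close> with
  \<open>a i * v i \<ge> v (i - 1) + v (i + 1)\<close> for all \<open>i\<close>. If all \<open>a i \<ge> 2\<close>, take \<open>v = 1\<close>. A point with
  \<open>a i = 1\<close> has no arc ends, so that the arc cutting it off is compatible with all arcs of \<open>T\<close> and
  hence belongs to \<open>T\<close>; remove the point and afterwards give it the sum of the values of \<open>v\<close> at its
  neighbours. The process does not remove the last point, for otherwise a spiralling arc starting
  there could be added to \<open>T\<close>.

  No two arcs have to be shown to cross: every step constructs disjoint representatives and appeals
  to the maximality of \<open>T\<close>.
\<close>

section \<open>Positivity of continuants\<close>

text \<open>Working with an inequality instead of an exact solution of the recurrence is what lets
  the constant 1 serve once no point can be removed. At a removed point the sum of the neighbouring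
  values is the smallest choice that count 1 allows. The arc cutting it off leaves the arc set
  together with the point, so each neighbour loses as much on the left of its inequality as on the
  right.

  Points are indexed by integers, that is, by their lifts to the strip. The two neighbours of a
  removed point may be the same point of the annulus; the arc is then a loop with two ends, yet it
  still spans an honest interval, of length \<open>n\<close>. The survival of a point separates
  annuli from polygons, where the reduction exhausts the vertices and friezes are finite.

  Representatives are arbitrary continuous curves. An arc cutting off points is therefore pushed
  towards the boundary, below whatever is given. To make room for a spiral, finite curves without
  outer ends are squeezed inside the meridian. Winding numbers only serve to show that the
  constructed arcs are arcs and that they differ from each other.\<close>

fun continuant :: "(int \<Rightarrow> int) \<Rightarrow> int \<Rightarrow> nat \<Rightarrow> int" where
  "continuant a i 0 = 0"
| "continuant a i (Suc 0) = 1"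
| "continuant a i (Suc (Suc k)) = a (i + int k) * continuant a i (Suc k) - continuant a i k"

text \<open>The continuants starting at \<open>i\<close> and at \<open>i + 1\<close> solve the same
  three-term recurrence in their right end, so their Casoratian is constant. This is the diamond
  rule of the frieze.\<close>

lemma continuant_wronskian:
  "continuant a i (Suc k) * continuant a (i + 1) (Suc k)
     - continuant a (i + 1) k * continuant a i (Suc (Suc k)) = 1"
proof (induction k)
  case (Suc k)
  define x y u v z where
    "x = continuant a i (Suc k)" and "y = continuant a i (Suc (Suc k))"
    and "u = continuant a (i + 1) k" and "v = continuant a (i + 1) (Suc k)"
    and "z = a (i + 1 + int k)"
  have 1: "continuant a i (Suc (Suc (Suc k))) = z * y - x"
    by (simp add: x_def y_def z_def ac_simps)
  have 2: "continuant a (i + 1) (Suc (Suc k)) = z * v - u"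
    by (simp add: u_def v_def z_def)
  have "x * v - u * y = 1"
    using Suc.IH unfolding x_def y_def u_def v_def .
  then show ?case
    unfolding 1 2 x_def[symmetric] y_def[symmetric] u_def[symmetric] v_def[symmetric]
    by (simp add: algebra_simps)
qed simp

text \<open>
  Sturm comparison: the discrete Wronskian of the continuants and of a positive supersolution
  \<open>v\<close> of the recurrence does not decrease.
\<close>

lemma continuant_pos:
  assumes v: "\<And>i. v i > 0" and super: "\<And>i. a i * v i \<ge> v (i - 1) + v (i + 1)"
  shows "continuant a i (Suc k) > 0"
proof -
  \<comment> \<open>Positivity alone is not inductive because of the subtraction in the recurrence.
    The last conjunct says that the continuants grow by a larger factor than
    \<open>v\<close>.\<close>
  have "continuant a i k \<ge> 0 \<and> continuant a i (Suc k) > 0 \<and>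
      continuant a i (Suc k) * v (i + int k - 1) > continuant a i k * v (i + int k)"
  proof (induction k)
    case 0
    then show ?case using v by simp
  next
    case (Suc k)
    define x y j z where
      "x = continuant a i k" and "y = continuant a i (Suc k)" and "j = i + int k"
      and "z = a (i + int k) * continuant a i (Suc k) - continuant a i k"
    have IH: "0 \<le> x" "0 < y" "y * v (j - 1) > x * v j"
      using Suc unfolding x_def y_def j_def by auto
    have "z * v j = y * (a j * v j) - x * v j"
      unfolding z_def x_def y_def j_def by (simp add: algebra_simps)
    moreover have "y * (a j * v j) \<ge> y * (v (j - 1) + v (j + 1))"
      using super IH by (intro mult_left_mono) auto
    ultimately have gt: "z * v j > y * v (j + 1)"
      using IH by (simp add: algebra_simps)
    moreover have "y * v (j + 1) > 0"
      using IH v by simp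
    ultimately have "z * v j > 0" by linarith
    then have "z > 0"
      using v[of j] by (simp add: zero_less_mult_iff)
    with gt IH show ?case
      unfolding x_def y_def z_def j_def by (simp add: algebra_simps)
  qed
  then show ?thesis by simp
qed

lemma infinite_frieze_if_supersolution:
  assumes "\<And>i. v i > 0" "\<And>i. a i * v i \<ge> v (i - 1) + v (i + 1)"
  shows "\<exists>F. infinite_frieze F \<and> (\<forall>i. quiddity_row F i = a i)"
proof -
  \<comment> \<open>The offset 2 turns the initial values 0 and 1 into the diagonals
    \<open>j = i - 2\<close> and \<open>j = i - 1\<close>.\<close>
  define F where "F i j = continuant a i (nat (j + 2 - i))" for i j :: int
  have F: "F i (i - 2) = 0" "F i (i - 1) = 1" "F i i = a i" for i
    by (simp_all add: F_def numeral_2_eq_2)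
  have "F i j > 0" if "i \<le> j" for i j
  proof -
    have "nat (j + 2 - i) = Suc (nat (j + 1 - i))"
      using that by simp
    then show ?thesis
      unfolding F_def using continuant_pos[of v a, OF assms] by metis
  qed
  moreover have "F i j * F (i + 1) (j + 1) - F (i + 1) j * F i (j + 1) = 1" if "j \<ge> i - 1" for i j
  proof -
    define k where "k = nat (j + 1 - i)"
    have "nat (j + 2 - i) = Suc k" "nat (j + 1 + 2 - i) = Suc (Suc k)"
      "nat (j + 2 - (i + 1)) = k" "nat (j + 1 + 2 - (i + 1)) = Suc k"
      using that unfolding k_def by auto
    then show ?thesis
      unfolding F_def using continuant_wronskian by metis
  qed
  ultimately show ?thesis
    unfolding infinite_frieze_def quiddity_row_def using F by blast
qed

section \<open>Cutting off points without arc ends\<close>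

text \<open>
  \<open>ear p s\<close> is the arc cutting off the points strictly between \<open>p\<close> and \<open>s\<close>. It can be drawn disjoint
  from \<open>\<beta>\<close> if \<open>\<beta>\<close> has no end at those points or if, conversely, \<open>\<beta>\<close> is an ear that cuts off no
  endpoint of \<open>ear p s\<close>; so \<open>ear_mem\<close> and \<open>spiral_mem\<close> express the maximality of \<open>T\<close>.
\<close>

locale ear_system =
  fixes n :: nat and T :: "'a set" and ends :: "int \<Rightarrow> 'a \<Rightarrow> nat" and ear :: "int \<Rightarrow> int \<Rightarrow> 'a"
  assumes n_pos: "n \<ge> 1"
    and ends_shift: "ends (i + k * int n) \<alpha> = ends i \<alpha>"
    and ends_ear: "\<lbrakk>2 \<le> s - p; s - p \<le> int n\<rbrakk> \<Longrightarrow>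
      ends i (ear p s) = of_bool (int n dvd i - p) + of_bool (int n dvd i - s)"
    and ear_eqD: "\<lbrakk>2 \<le> s - p; s - p \<le> int n; 2 \<le> s' - p'; s' - p' \<le> int n; ear p s = ear p' s'\<rbrakk> \<Longrightarrow>
      \<exists>k. p' = p + k * int n \<and> s' = s + k * int n"
    and finite_ends: "finite {\<alpha> \<in> T. ends i \<alpha> \<noteq> 0}"
    and ear_mem: "\<lbrakk>2 \<le> s - p; s - p \<le> int n;
      \<And>\<beta>. \<beta> \<in> T \<Longrightarrow> (\<forall>i. p < i \<and> i < s \<longrightarrow> ends i \<beta> = 0) \<or>
        (\<exists>p' s'. \<beta> = ear p' s' \<and> 2 \<le> s' - p' \<and> s' - p' \<le> int n \<and>
          (\<forall>i. p' < i \<and> i < s' \<longrightarrow> ends i (ear p s) = 0))\<rbrakk> \<Longrightarrow> ear p s \<in> T"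
    and spiral_mem: "(\<And>\<beta>. \<beta> \<in> T \<Longrightarrow> (\<forall>i. ends i \<beta> = 0) \<or>
        (\<exists>p' s'. \<beta> = ear p' s' \<and> 2 \<le> s' - p' \<and> s' - p' \<le> int n \<and>
          (\<forall>i. p' < i \<and> i < s' \<longrightarrow> \<not> int n dvd i - p))) \<Longrightarrow>
      \<exists>\<beta>\<in>T. ends p \<beta> \<noteq> 0 \<and>
        (\<forall>p' s'. 2 \<le> s' - p' \<and> s' - p' \<le> int n \<longrightarrow> \<beta> \<noteq> ear p' s')"
begin

text \<open>The set is a parameter because arcs are discarded during the reduction. Restricting the
  sum to arcs with an end at \<open>i\<close> makes it finite, whether or not \<open>T\<close>
  is.\<close>

definition num_triangles :: "'a set \<Rightarrow> int \<Rightarrow> nat" where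
  "num_triangles U i = 1 + (\<Sum>\<alpha>\<in>{\<alpha> \<in> U. ends i \<alpha> \<noteq> 0}. ends i \<alpha>)"

lemma num_triangles_eq_1D:
  assumes "U \<subseteq> T" "num_triangles U i < 2" "\<alpha> \<in> U"
  shows "ends i \<alpha> = 0"
proof -
  have "finite {\<alpha> \<in> U. ends i \<alpha> \<noteq> 0}"
    by (rule finite_subset[OF _ finite_ends[of i]]) (use assms(1) in auto)
  moreover have "(\<Sum>\<alpha>\<in>{\<alpha> \<in> U. ends i \<alpha> \<noteq> 0}. ends i \<alpha>) = 0"
    using assms(2) unfolding num_triangles_def by simp
  ultimately show ?thesis
    using assms(3) by (auto simp: sum_eq_0_iff)
qed

lemma num_triangles_remove:
  assumes "U \<subseteq> T" "\<alpha> \<in> U"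
  shows "num_triangles U i = num_triangles (U - {\<alpha>}) i + ends i \<alpha>"
proof -
  let ?A = "\<lambda>U. {\<alpha> \<in> U. ends i \<alpha> \<noteq> 0}"
  have fin: "finite (?A U)"
    by (rule finite_subset[OF _ finite_ends[of i]]) (use assms(1) in auto)
  show ?thesis
  proof (cases "ends i \<alpha> = 0")
    case True
    then have "?A (U - {\<alpha>}) = ?A U" by auto
    then show ?thesis
      using True unfolding num_triangles_def by simp
  next
    case False
    have "?A (U - {\<alpha>}) = ?A U - {\<alpha>}" by auto
    moreover have "sum (ends i) (?A U) = ends i \<alpha> + sum (ends i) (?A U - {\<alpha>})"
      using fin False assms(2) by (intro sum.remove) auto
    ultimately show ?thesis
      unfolding num_triangles_def by simp
  qed
qed

lemma dvd_diffE:
  fixes i j :: int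
  assumes "int n dvd i - j"
  obtains k where "i = j + k * int n"
  using assms by (metis add.commute diff_add_cancel dvd_def mult.commute)

text \<open>
  \<open>S\<close> consists of the points that have not been cut off yet, with predecessor \<open>l\<close> and
  successor \<open>r\<close>, and \<open>U\<close> consists of the arcs that are not ears cutting off removed points.
  A point \<open>i\<close> without ends in \<open>U\<close> is removed; the arc from \<open>l i\<close> to \<open>r i\<close> then belongs to \<open>T\<close> by
  maximality.
\<close>

lemma ex_supersolution:
  assumes "U \<subseteq> T" "S \<noteq> {}"
    and "\<And>i k. i \<in> S \<Longrightarrow> i + k * int n \<in> S"
    and "\<And>i. i \<in> S \<Longrightarrow> l i \<in> S \<and> l i < i \<and> r (l i) = i"
    and "\<And>i. i \<in> S \<Longrightarrow> r i \<in> S \<and> i < r i \<and> l (r i) = i"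
    and "\<And>i j. i \<in> S \<Longrightarrow> j \<in> S \<Longrightarrow> j \<le> i \<or> r i \<le> j"
    and "\<And>i k. i \<in> S \<Longrightarrow> l (i + k * int n) = l i + k * int n"
    and "\<And>i k. i \<in> S \<Longrightarrow> r (i + k * int n) = r i + k * int n"
    and "\<And>\<alpha> i. \<alpha> \<in> U \<Longrightarrow> ends i \<alpha> \<noteq> 0 \<Longrightarrow> i \<in> S"
    and "\<And>\<alpha>. \<alpha> \<in> T - U \<Longrightarrow>
      \<exists>p s j. \<alpha> = ear p s \<and> 2 \<le> s - p \<and> s - p \<le> int n \<and> j \<in> S \<and> j \<le> p \<and> s \<le> r j"
  shows "\<exists>v :: int \<Rightarrow> int. (\<forall>i. v i > 0) \<and> (\<forall>i k. v (i + k * int n) = v i) \<and>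
    (\<forall>i\<in>S. int (num_triangles U i) * v i \<ge> v (l i) + v (r i))"
  using assms
\<comment> \<open>As \<open>S\<close> is periodic, this cardinality counts the classes modulo
  \<open>n\<close> that are still present.\<close>
proof (induction "card (S \<inter> {0..<int n})" arbitrary: S U l r rule: less_induct)
  case less
  note US = less.prems(1) and shift = less.prems(3) and lS = less.prems(4) and rS = less.prems(5)
    and gap = less.prems(6) and l_shift = less.prems(7) and r_shift = less.prems(8)
    and U_ends = less.prems(9) and ears = less.prems(10)
  show ?case
  proof (cases "\<forall>i\<in>S. num_triangles U i \<ge> 2")
    case True
    then show ?thesis
      by (intro exI[of _ "\<lambda>_. 1"]) auto
  next
    case False
    then obtain i0 where i0: "i0 \<in> S" "num_triangles U i0 < 2"
      by auto
    have no_ends: "ends i0 \<alpha> = 0" if "\<alpha> \<in> U" for \<alpha>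
      using num_triangles_eq_1D[OF US i0(2) that] .
    have no_ends': "ends i \<alpha> = 0" if "\<alpha> \<in> U" "int n dvd i - i0" for i \<alpha>
      using dvd_diffE[OF that(2)] no_ends[OF that(1)] ends_shift by metis
    define p s where "p = l i0" and "s = r i0"
    have pS: "p \<in> S" "p < i0" "r p = i0" and sS: "s \<in> S" "i0 < s" "l s = i0"
      using lS rS i0 unfolding p_def s_def by auto
    have no_gap: "False" if "i \<in> S" "j \<in> S" "j < i" "i < r j" for i j
      using gap[of j i] that by auto
    show ?thesis
    proof (cases "s = i0 + int n")
      \<comment> \<open>Only the class of \<open>i0\<close> is left, and no arc of \<open>U\<close>
        ends there.\<close>
      case True
      have S_class: "int n dvd i - i0" if "i \<in> S" for i
      proof (rule ccontr)
        assume *: "\<not> int n dvd i - i0"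
        \<comment> \<open>The translate of \<open>i\<close> between \<open>i0\<close> and
          \<open>i0 + n\<close>, an interval whose interior contains no point of
          \<open>S\<close>.\<close>
        define j where "j = i + (- ((i - i0) div int n)) * int n"
        have "j \<in> S" unfolding j_def using that shift by blast
        have "j - i0 = (i - i0) mod int n"
          unfolding j_def by (simp add: minus_div_mult_eq_mod[symmetric])
        then have "0 < j - i0" "j - i0 < int n"
          using * n_pos pos_mod_sign[of "int n" "i - i0"] pos_mod_bound[of "int n" "i - i0"]
          by (auto simp: dvd_eq_mod_eq_0 order_less_le simp del: pos_mod_sign pos_mod_bound)
        then show False
          using no_gap[OF \<open>j \<in> S\<close> i0(1)] True unfolding s_def by auto
      qed
      \<comment> \<open>The arc obtained here cannot lie in \<open>U\<close>, since it ends at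
        \<open>i0\<close>, nor outside \<open>U\<close>, since it is not an ear: a
        contradiction.\<close>
      have "\<exists>\<beta>\<in>T. ends i0 \<beta> \<noteq> 0 \<and>
        (\<forall>p' s'. 2 \<le> s' - p' \<and> s' - p' \<le> int n \<longrightarrow> \<beta> \<noteq> ear p' s')"
      proof (rule spiral_mem)
        fix \<beta> assume "\<beta> \<in> T"
        show "(\<forall>i. ends i \<beta> = 0) \<or> (\<exists>p' s'. \<beta> = ear p' s' \<and> 2 \<le> s' - p' \<and> s' - p' \<le> int n \<and>
          (\<forall>i. p' < i \<and> i < s' \<longrightarrow> \<not> int n dvd i - i0))"
        proof (cases "\<beta> \<in> U")
          case True
          then show ?thesis
            using U_ends S_class no_ends' by blast
        next
          case False
          then obtain p' s' j where *: "\<beta> = ear p' s'" "2 \<le> s' - p'" "s' - p' \<le> int n"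
            "j \<in> S" "j \<le> p'" "s' \<le> r j"
            using ears \<open>\<beta> \<in> T\<close> by blast
          have "\<not> int n dvd i - i0" if "p' < i" "i < s'" for i
          proof
            assume "int n dvd i - i0"
            then have "i \<in> S" using shift[OF i0(1)] by (metis dvd_diffE)
            with no_gap * that show False by (metis order_le_less_trans order_less_le_trans)
          qed
          with * show ?thesis by blast
        qed
      qed
      then obtain \<beta> where "\<beta> \<in> T" "ends i0 \<beta> \<noteq> 0"
        "\<And>p' s'. 2 \<le> s' - p' \<and> s' - p' \<le> int n \<Longrightarrow> \<beta> \<noteq> ear p' s'"
        by blast
      moreover from this no_ends have "\<beta> \<in> T - U" by auto
      ultimately show ?thesis using ears by blast
    next
      case False
      have "i0 + int n \<in> S" using shift[OF i0(1), of 1] by simp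
      with gap[OF i0(1), of "i0 + int n"] n_pos have "s \<le> i0 + int n"
        unfolding s_def by auto
      with False have s_less: "s < i0 + int n" by simp
      \<comment> \<open>Otherwise \<open>p + n\<close>, a point of \<open>S\<close> after
        \<open>p\<close> and not beyond the successor \<open>i0\<close> of \<open>p\<close>, equals
        \<open>i0\<close>, and there is only one class.\<close>
      have p_gt: "i0 < p + int n"
      proof (rule ccontr)
        assume "\<not> i0 < p + int n"
        moreover have "p + int n \<in> S" using shift[OF pS(1), of 1] by simp
        ultimately have "p + int n = i0"
          using no_gap[OF _ pS(1), of "p + int n"] pS(3) n_pos by force
        then have "r i0 = i0 + int n"
          using r_shift[OF pS(1), of 1] pS(3) by simp
        with False show False unfolding s_def by simp
      qed
      have "p + int n \<in> S" using shift[OF pS(1), of 1] by simp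
      with gap[OF i0(1)] p_gt have "s \<le> p + int n" unfolding s_def by force
      \<comment> \<open>Equality \<open>s - p = n\<close> occurs when exactly two classes are left;
        the ear is then a loop.\<close>
      then have ps: "2 \<le> s - p" "s - p \<le> int n"
        using pS sS by auto
      \<comment> \<open>The only point of \<open>S\<close> strictly between \<open>p\<close> and
        \<open>s\<close> is \<open>i0\<close>, so arcs of \<open>U\<close> have no ends there. The
        other arcs are ears over gaps of \<open>S\<close>, and such a gap contains no translate of
        \<open>p\<close> or \<open>s\<close>.\<close>
      have ear_T: "ear p s \<in> T"
      proof (rule ear_mem[OF ps])
        fix \<beta> assume "\<beta> \<in> T"
        show "(\<forall>i. p < i \<and> i < s \<longrightarrow> ends i \<beta> = 0) \<or>
          (\<exists>p' s'. \<beta> = ear p' s' \<and> 2 \<le> s' - p' \<and> s' - p' \<le> int n \<and>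
            (\<forall>i. p' < i \<and> i < s' \<longrightarrow> ends i (ear p s) = 0))"
        proof (cases "\<beta> \<in> U")
          case True
          have "ends i \<beta> = 0" if "p < i" "i < s" for i
          proof (cases "i = i0")
            case False
            then have "i \<notin> S"
              using that no_gap[OF _ pS(1), of i] no_gap[OF _ i0(1), of i] pS(3)
              unfolding s_def by force
            then show ?thesis using U_ends True by blast
          qed (use no_ends True in simp)
          then show ?thesis by blast
        next
          case False
          then obtain p' s' j where *: "\<beta> = ear p' s'" "2 \<le> s' - p'" "s' - p' \<le> int n"
            "j \<in> S" "j \<le> p'" "s' \<le> r j"
            using ears \<open>\<beta> \<in> T\<close> by blast
          have "ends i (ear p s) = 0" if "p' < i" "i < s'" for i
          proof -
            have "i \<notin> S"
              using no_gap * that by (metis order_le_less_trans order_less_le_trans)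
            then have "\<not> int n dvd i - p" "\<not> int n dvd i - s"
              using shift[OF pS(1)] shift[OF sS(1)] by (metis dvd_diffE)+
            then show ?thesis using ends_ear[OF ps] by simp
          qed
          with * show ?thesis by blast
        qed
      qed
      \<comment> \<open>Otherwise the ear, up to a translation, would span a gap of
        \<open>S\<close>, although it cuts off a translate of \<open>i0\<close>.\<close>
      have ear_U: "ear p s \<in> U"
      proof (rule ccontr)
        assume "ear p s \<notin> U"
        then obtain p' s' j where *: "ear p s = ear p' s'" "2 \<le> s' - p'" "s' - p' \<le> int n"
            "j \<in> S" "j \<le> p'" "s' \<le> r j"
          using ears ear_T by blast
        obtain k where "p' = p + k * int n" "s' = s + k * int n"
          using ear_eqD[OF ps *(2,3,1)] by blast
        with * pS sS have "j < i0 + k * int n" "i0 + k * int n < r j" by auto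
        then show False using no_gap[OF shift[OF i0(1)] *(4)] by blast
      qed
      define S' where "S' = {i \<in> S. \<not> int n dvd i - i0}"
      \<comment> \<open>Skipping once is enough: by \<open>p_class\<close> and
        \<open>s_class\<close> the neighbours of a removed point are not themselves removed.\<close>
      define l' where "l' i = (if int n dvd l i - i0 then l (l i) else l i)" for i
      define r' where "r' i = (if int n dvd r i - i0 then r (r i) else r i)" for i
      have r_class: "int n dvd r i - i0 \<longleftrightarrow> int n dvd i - p" if "i \<in> S" for i
      proof
        assume "int n dvd r i - i0"
        then obtain k where "r i = i0 + k * int n" by (rule dvd_diffE)
        then have "i = p + k * int n"
          using rS[OF that] l_shift[OF i0(1)] unfolding p_def by metis
        then show "int n dvd i - p" by simp
      next
        assume "int n dvd i - p"
        then obtain k where "i = p + k * int n" by (rule dvd_diffE)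
        then show "int n dvd r i - i0" using r_shift[OF pS(1)] pS(3) by simp
      qed
      have l_class: "int n dvd l i - i0 \<longleftrightarrow> int n dvd i - s" if "i \<in> S" for i
      proof
        assume "int n dvd l i - i0"
        then obtain k where "l i = i0 + k * int n" by (rule dvd_diffE)
        then have "i = s + k * int n"
          using lS[OF that] r_shift[OF i0(1)] unfolding s_def by metis
        then show "int n dvd i - s" by simp
      next
        assume "int n dvd i - s"
        then obtain k where "i = s + k * int n" by (rule dvd_diffE)
        then show "int n dvd l i - i0" using l_shift[OF sS(1)] sS(3) by simp
      qed
      have p_class: "\<not> int n dvd p - i0" and s_class: "\<not> int n dvd s - i0"
        using zdvd_not_zless[of "i0 - p" "int n"] zdvd_not_zless[of "s - i0" "int n"]
          pS(2) sS(2) s_less p_gt dvd_diff_commute[of "int n" p i0] by auto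
      have class_shift: "int n dvd i + k * int n - j \<longleftrightarrow> int n dvd i - j" for i j k
        by (metis (no_types, opaque_lifting) add.commute add_diff_eq diff_add_eq dvd_add_right_iff dvd_triv_right)
      have S'_shift: "i + k * int n \<in> S'" if "i \<in> S'" for i k
        using that shift class_shift unfolding S'_def by auto
      have r_r: "r (r i) = s + k * int n" if "r i = i0 + k * int n" for i k
        using that r_shift[OF i0(1)] unfolding s_def by simp
      have l_l: "l (l i) = p + k * int n" if "l i = i0 + k * int n" for i k
        using that l_shift[OF i0(1)] unfolding p_def by simp
      have l'S: "l' i \<in> S' \<and> l' i < i \<and> r' (l' i) = i" if "i \<in> S'" for i
      proof (cases "int n dvd l i - i0")
        case True
        then obtain k where k: "l i = i0 + k * int n" by (rule dvd_diffE)
        have "\<not> int n dvd l (l i) - i0"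
          unfolding l_l[OF k] class_shift by (rule p_class)
        moreover have "r (l (l i)) = l i" "r (l i) = i" "l (l i) \<in> S" "l (l i) < i"
          using that lS[of i] lS[of "l i"] unfolding S'_def by auto
        ultimately show ?thesis
          using True unfolding l'_def r'_def S'_def by simp
      next
        case False
        then show ?thesis
          using that lS[of i] unfolding l'_def r'_def S'_def by auto
      qed
      have r'S: "r' i \<in> S' \<and> i < r' i \<and> l' (r' i) = i" if "i \<in> S'" for i
      proof (cases "int n dvd r i - i0")
        case True
        then obtain k where k: "r i = i0 + k * int n" by (rule dvd_diffE)
        have "\<not> int n dvd r (r i) - i0"
          unfolding r_r[OF k] class_shift by (rule s_class)
        moreover have "l (r (r i)) = r i" "l (r i) = i" "r (r i) \<in> S" "i < r (r i)"
          using that rS[of i] rS[of "r i"] unfolding S'_def by auto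
        ultimately show ?thesis
          using True unfolding l'_def r'_def S'_def by simp
      next
        case False
        then show ?thesis
          using that rS[of i] unfolding l'_def r'_def S'_def by auto
      qed
      have gap': "j \<le> i \<or> r' i \<le> j" if "i \<in> S'" "j \<in> S'" for i j
      proof (cases "int n dvd r i - i0")
        case True
        have "j \<noteq> r i" using that True unfolding S'_def by auto
        then show ?thesis
          using True that gap[of i j] gap[of "r i" j] rS[of i] unfolding r'_def S'_def by force
      next
        case False
        then show ?thesis
          using that gap[of i j] unfolding r'_def S'_def by auto
      qed
      define U' where "U' = U - {ear p s}"
      have "\<exists>v :: int \<Rightarrow> int. (\<forall>i. v i > 0) \<and> (\<forall>i k. v (i + k * int n) = v i) \<and>
        (\<forall>i\<in>S'. int (num_triangles U' i) * v i \<ge> v (l' i) + v (r' i))"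
      proof (rule less.hyps)
        show "card (S' \<inter> {0..<int n}) < card (S \<inter> {0..<int n})"
        proof (rule psubset_card_mono)
          have "i0 mod int n \<in> S" using shift[OF i0(1), of "- (i0 div int n)"]
            by (simp add: minus_div_mult_eq_mod)
          moreover have "i0 mod int n \<notin> S'"
            unfolding S'_def by (simp add: mod_eq_dvd_iff[symmetric])
          moreover have "i0 mod int n \<in> {0..<int n}" using n_pos by simp
          ultimately show "S' \<inter> {0..<int n} \<subset> S \<inter> {0..<int n}"
            unfolding S'_def by blast
        qed simp
        show "U' \<subseteq> T" using US unfolding U'_def by auto
        show "S' \<noteq> {}" using pS(1) p_class unfolding S'_def by auto
        show "l' (i + k * int n) = l' i + k * int n" if "i \<in> S'" for i k
          using that l_shift lS class_shift unfolding S'_def l'_def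
          by (auto simp: diff_add_eq[symmetric])
        show "r' (i + k * int n) = r' i + k * int n" if "i \<in> S'" for i k
          using that r_shift rS class_shift unfolding S'_def r'_def
          by (auto simp: diff_add_eq[symmetric])
        show "i \<in> S'" if "\<alpha> \<in> U'" "ends i \<alpha> \<noteq> 0" for \<alpha> i
          using that U_ends no_ends' unfolding U'_def S'_def by auto
        show "\<exists>p s j. \<alpha> = ear p s \<and> 2 \<le> s - p \<and> s - p \<le> int n \<and> j \<in> S' \<and> j \<le> p \<and> s \<le> r' j"
          if "\<alpha> \<in> T - U'" for \<alpha>
        proof (cases "\<alpha> = ear p s")
          case True
          have "p \<in> S'" "r' p = s"
            using pS(1) p_class unfolding S'_def r'_def pS(3) s_def by auto
          with True ps show ?thesis by blast
        next
          case False
          then have "\<alpha> \<in> T - U" using that unfolding U'_def by auto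
          from ears[OF this] obtain p' s' j where *: "\<alpha> = ear p' s'" "2 \<le> s' - p'"
            "s' - p' \<le> int n" "j \<in> S" "j \<le> p'" "s' \<le> r j"
            by blast
          show ?thesis
          proof (cases "int n dvd j - i0")
            case True
            \<comment> \<open>The gap that began at the removed point \<open>j\<close> is absorbed
              into the one from \<open>l j\<close> to \<open>r j\<close>.\<close>
            have lj: "l j \<in> S" "l j < j" "r (l j) = j" using lS[OF *(4)] by auto
            obtain k where k: "j = i0 + k * int n" using True by (rule dvd_diffE)
            have "\<not> int n dvd l j - i0"
              using k l_shift[OF i0(1)] p_class class_shift unfolding p_def by simp
            then have "l j \<in> S'" using lj unfolding S'_def by auto
            moreover have "r' (l j) = r j" using lj True unfolding r'_def by simp
            moreover have "l j \<le> p'" "s' \<le> r j" using lj * by auto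
            ultimately show ?thesis
              using *(1-3) by metis
          next
            case False
            have "r j \<le> r' j" using rS[of j] rS[of "r j"] *(4) unfolding r'_def by force
            with * False have "j \<in> S'" "s' \<le> r' j" unfolding S'_def by auto
            with * show ?thesis by blast
          qed
        qed
      qed (use S'_shift l'S r'S gap' in auto)
      then obtain v' :: "int \<Rightarrow> int" where v'_pos: "\<And>i. v' i > 0"
        and v'_shift: "\<And>i k. v' (i + k * int n) = v' i"
        and v': "\<And>i. i \<in> S' \<Longrightarrow> int (num_triangles U' i) * v' i \<ge> v' (l' i) + v' (r' i)"
        by blast
      \<comment> \<open>With count 1 at \<open>i0\<close>, this choice gives equality there.\<close>
      define v where "v i = (if int n dvd i - i0 then v' p + v' s else v' i)" for i
      have "v i > 0" for i
        using v'_pos unfolding v_def by (simp add: add_pos_pos)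
      moreover have "v (i + k * int n) = v i" for i k
        unfolding v_def using class_shift v'_shift by simp
      moreover have "int (num_triangles U i) * v i \<ge> v (l i) + v (r i)" if "i \<in> S" for i
      proof (cases "int n dvd i - i0")
        case True
        then obtain k where "i = i0 + k * int n" by (rule dvd_diffE)
        then have "l i = p + k * int n" "r i = s + k * int n"
          using l_shift[OF i0(1)] r_shift[OF i0(1)] unfolding p_def s_def by auto
        then have "v (l i) = v' p" "v (r i) = v' s"
          using p_class s_class class_shift v'_shift unfolding v_def by auto
        moreover have "v i = v' p + v' s" using True unfolding v_def by simp
        moreover have "num_triangles U i \<ge> 1" unfolding num_triangles_def by simp
        ultimately show ?thesis
          using v'_pos[of p] v'_pos[of s] by (simp add: mult_le_cancel_right1)
      next
        case False
        then have "i \<in> S'" using that unfolding S'_def by simp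
        have vi: "v i = v' i" using False unfolding v_def by simp
        have vr: "v (r i) = v' (r' i) + of_bool (int n dvd i - p) * v' i"
        proof (cases "int n dvd i - p")
          case True
          then obtain k where k: "i = p + k * int n" by (rule dvd_diffE)
          then have "r i = i0 + k * int n" using r_shift[OF pS(1)] pS(3) by simp
          then have "v (r i) = v' p + v' s" "v' (r' i) = v' s"
            using r_r v'_shift unfolding v_def r'_def by auto
          then show ?thesis using k v'_shift by simp
        next
          case False
          then show ?thesis using r_class[OF that] unfolding v_def r'_def by simp
        qed
        have vl: "v (l i) = v' (l' i) + of_bool (int n dvd i - s) * v' i"
        proof (cases "int n dvd i - s")
          case True
          then obtain k where k: "i = s + k * int n" by (rule dvd_diffE)
          then have "l i = i0 + k * int n" using l_shift[OF sS(1)] sS(3) by simp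
          then have "v (l i) = v' p + v' s" "v' (l' i) = v' p"
            using l_l v'_shift unfolding v_def l'_def by auto
          then show ?thesis using k v'_shift by simp
        next
          case False
          then show ?thesis using l_class[OF that] unfolding v_def l'_def by simp
        qed
        \<comment> \<open>Each end of the ear at \<open>i\<close> adds \<open>v' i\<close> on the
          left, and on the right one neighbour value grows by \<open>v' i\<close>. The two
          indicators may both be 1, namely for a loop.\<close>
        have "int (num_triangles U i) * v' i =
            int (num_triangles U' i) * v' i +
            of_bool (int n dvd i - p) * v' i + of_bool (int n dvd i - s) * v' i"
          unfolding num_triangles_remove[OF US ear_U] U'_def ends_ear[OF ps]
          by (simp add: algebra_simps)
        then show ?thesis
          using v'[OF \<open>i \<in> S'\<close>] unfolding vi vr vl by linarith
      qed
      ultimately show ?thesis by blast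
    qed
  qed
qed

theorem infinite_frieze_num_triangles:
  "\<exists>F. infinite_frieze F \<and> (\<forall>i. quiddity_row F i = int (num_triangles T i))"
proof -
  \<comment> \<open>At the start no point is removed and \<open>U = T\<close>, so the condition on
    discarded arcs is vacuous.\<close>
  have "\<exists>v :: int \<Rightarrow> int. (\<forall>i. v i > 0) \<and> (\<forall>i k. v (i + k * int n) = v i) \<and>
    (\<forall>i\<in>UNIV. int (num_triangles T i) * v i \<ge> v (i - 1) + v (i + 1))"
    by (rule ex_supersolution) auto
  then show ?thesis
    using infinite_frieze_if_supersolution[of _ "\<lambda>i. int (num_triangles T i)"] by auto
qed

end

section \<open>Arcs close to the outer boundary\<close>

lemma interior_annulus: "interior annulus = {w. 1 < norm w \<and> norm w < 2}"
proof -
  have annulus: "annulus = cball 0 2 \<inter> (- ball 0 1)"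
    by (auto simp: annulus_def)
  have "interior annulus = ball 0 2 \<inter> (- cball 0 1)"
    unfolding annulus interior_Int interior_complement by simp
  then show ?thesis
    by (simp add: set_eq_iff not_le conj_commute)
qed

text \<open>Segments suffice for the isotopies constructed below, as these change only the radius of
  each point and not its angle.\<close>

lemma homotopic_with_linearI:
  fixes f g :: "'a::topological_space \<Rightarrow> 'b::real_normed_vector"
  assumes f: "continuous_on S f" and g: "continuous_on S g"
    and T: "\<And>u x. u \<in> {0..1} \<Longrightarrow> x \<in> S \<Longrightarrow> (1 - u) *\<^sub>R f x + u *\<^sub>R g x \<in> T"
    and P: "\<And>u. u \<in> {0..1} \<Longrightarrow> P (\<lambda>x. (1 - u) *\<^sub>R f x + u *\<^sub>R g x)"
  shows "homotopic_with_canon P S T f g"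
proof -
  let ?h = "\<lambda>y. (1 - fst y) *\<^sub>R (f \<circ> snd) y + fst y *\<^sub>R (g \<circ> snd) y"
  have "continuous_on ({0..1} \<times> S) ?h"
    by (intro continuous_intros continuous_on_compose continuous_on_subset[OF f]
        continuous_on_subset[OF g]) auto
  then show ?thesis
    unfolding homotopic_with_def using T P
    by (intro exI[of _ ?h]) (auto simp: image_subset_iff)
qed

section \<open>The outer circle in a lifted coordinate\<close>

lemma cis_eq_iff_int: "cis a = cis b \<longleftrightarrow> (\<exists>k::int. a = b + 2 * pi * k)"
proof -
  have "cis a = cis b \<longleftrightarrow> sin a = sin b \<and> cos a = cos b"
    by (auto simp: complex_eq_iff)
  also have "\<dots> \<longleftrightarrow> (\<exists>k\<in>\<int>. a = b + 2 * pi * k)"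
    by (subst sin_cos_eq_iff) (auto simp: algebra_simps elim!: Ints_cases)
  finally show ?thesis by (metis Ints_cases Ints_of_int)
qed

text \<open>The covering map of the outer circle, in the real coordinate whose integers are the
  lifts of the outer marked points.\<close>

definition outer_point :: "nat \<Rightarrow> real \<Rightarrow> complex" where
  "outer_point n x = 2 * cis (2 * pi * (x - 1) / real n)"

lemma norm_outer_point [simp]: "norm (outer_point n x) = 2"
  by (simp add: outer_point_def norm_mult)

lemma outer_point_neq_0 [simp]: "outer_point n x \<noteq> 0"
  by (simp add: outer_point_def)

lemma outer_point_eq_iff:
  assumes "n \<ge> 1"
  shows "outer_point n x = outer_point n y \<longleftrightarrow> (\<exists>k::int. x = y + real_of_int k * real n)"
proof -
  have "2 * pi * (x - 1) / real n = 2 * pi * (y - 1) / real n + 2 * pi * real_of_int k \<longleftrightarrow>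
      x = y + real_of_int k * real n" for k :: int
  proof -
    have "2 * pi * (x - 1) / real n = 2 * pi * (y - 1) / real n + 2 * pi * real_of_int k \<longleftrightarrow>
        (2 * pi) * (x - 1) = (2 * pi) * ((y - 1) + real_of_int k * real n)"
      using assms by (simp add: field_simps)
    also have "\<dots> \<longleftrightarrow> x = y + real_of_int k * real n"
      by (subst mult_left_cancel) auto
    finally show ?thesis .
  qed
  then show ?thesis
    unfolding outer_point_def by (simp add: cis_eq_iff_int)
qed

lemma outer_point_int_eq_iff:
  assumes "n \<ge> 1"
  shows "outer_point n (of_int i) = outer_point n (of_int j) \<longleftrightarrow> int n dvd i - j"
proof -
  have "real_of_int i = real_of_int j + real_of_int k * real n \<longleftrightarrow> i - j = int n * k" for k
  proof -
    have "real_of_int i = real_of_int j + real_of_int k * real n \<longleftrightarrow>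
        real_of_int i = real_of_int (j + k * int n)" by simp
    also have "\<dots> \<longleftrightarrow> i = j + k * int n" by (rule of_int_eq_iff)
    finally show ?thesis by (auto simp: algebra_simps)
  qed
  then show ?thesis
    unfolding outer_point_eq_iff[OF assms] dvd_def by simp
qed

lemma outer_point_shift:
  "n \<ge> 1 \<Longrightarrow> outer_point n (x + real_of_int k * real n) = outer_point n x"
  by (subst outer_point_eq_iff) auto

lemma continuous_on_outer_point [continuous_intros]:
  "continuous_on A f \<Longrightarrow> continuous_on A (\<lambda>t. outer_point n (f t))"
  unfolding outer_point_def divide_inverse by (intro continuous_intros)

lemma marked_point_outer: "k \<le> n \<Longrightarrow> marked_point n m k = outer_point n (real k)"
  by (simp add: marked_point_def outer_point_def)

lemma outer_point_int_eq_nat: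
  assumes "n \<ge> 1"
  shows "outer_point n (of_int i) = outer_point n (real (nat ((i - 1) mod int n) + 1))"
proof -
  have "real (nat ((i - 1) mod int n) + 1) = of_int ((i - 1) mod int n + 1)"
    using assms by simp
  moreover have "int n dvd i - ((i - 1) mod int n + 1)"
    by (metis diff_add_eq_diff_diff_swap diff_right_commute dvd_minus_mod)
  ultimately show ?thesis
    using outer_point_int_eq_iff[OF assms] by metis
qed

lemma outer_point_in_marked_points:
  assumes "n \<ge> 1"
  shows "outer_point n (of_int i) \<in> marked_points n m"
proof -
  define k where "k = nat ((i - 1) mod int n) + 1"
  have "0 \<le> (i - 1) mod int n" "(i - 1) mod int n < int n" using assms by simp_all
  then have "k \<in> {1..n}" unfolding k_def by auto
  moreover from this have "marked_point n m k = outer_point n (of_int i)"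
    using outer_point_int_eq_nat[OF assms, of i] by (simp only: marked_point_outer atLeastAtMost_iff k_def)
  ultimately show ?thesis
    unfolding marked_points_def by (intro image_eqI[of _ _ k]) auto
qed

lemma marked_points_cases:
  assumes "w \<in> marked_points n m"
  obtains i :: int where "w = outer_point n (of_int i)" | "norm w = 1"
proof -
  obtain k where k: "w = marked_point n m k" using assms unfolding marked_points_def by auto
  show ?thesis
  proof (cases "k \<le> n")
    case True
    then show ?thesis using that(1)[of "int k"] k by (simp add: marked_point_outer)
  next
    case False
    then show ?thesis using that(2) k by (simp add: marked_point_def)
  qed
qed

section \<open>Paths whose angle grows linearly\<close>

definition polar_path :: "nat \<Rightarrow> real \<Rightarrow> real \<Rightarrow> (real \<Rightarrow> real) \<Rightarrow> real \<Rightarrow> complex" where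
  "polar_path n x y r t = r t *\<^sub>R outer_point n (x + t * y)"

text \<open>The path is \<open>exp\<close> of a path \<open>q\<close> whose imaginary part is the
  angle. It need not be closed: a change of radius enters the imaginary part of the winding number,
  so only the real part is used.\<close>

lemma winding_number_polar_path:
  assumes "continuous_on {0..1} r" "\<And>t. t \<in> {0..1} \<Longrightarrow> r t > 0"
  shows "Re (winding_number (polar_path n x y r) 0) = y / real n"
proof -
  define q where "q t = complex_of_real (ln (2 * r t)) + \<i> * complex_of_real (2 * pi * (x + t * y - 1) / real n)" for t
  have "path q"
    unfolding path_def q_def divide_inverse
    using assms by (intro continuous_intros) (auto simp: less_imp_neq[symmetric])
  have "winding_number (polar_path n x y r) 0 = winding_number (exp \<circ> q) 0"
  proof (rule winding_number_cong)
    fix t :: real assume "0 \<le> t" "t \<le> 1"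
    then have "r t > 0" using assms by simp
    then show "polar_path n x y r t = (exp \<circ> q) t"
      unfolding polar_path_def q_def outer_point_def o_def exp_add
      by (simp add: cis_conv_exp scaleR_conv_of_real exp_of_real)
  qed
  also have "\<dots> = (q 1 - q 0) / (2 * of_real pi * \<i>)"
    using winding_number_compose_exp[OF \<open>path q\<close>] by (simp add: pathfinish_def pathstart_def)
  also have "Re \<dots> = Im (q 1 - q 0) / (2 * pi)"
    by (simp add: Re_divide power2_eq_square field_simps)
  also have "\<dots> = (2 * pi * (x + y - 1) / real n - 2 * pi * (x - 1) / real n) / (2 * pi)"
    unfolding q_def by simp
  also have "\<dots> = y / real n"
    by (simp add: diff_divide_distrib[symmetric]) (simp add: algebra_simps)
  finally show ?thesis .
qed

text \<open>The winding number about 0 is invariant under homotopies in the punctured plane. Besides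
  the endpoints, this is the invariant that tells curves apart.\<close>

lemma homotopic_polar_paths_angle_eq:
  assumes "n \<ge> 1" and hom: "homotopic_paths annulus (polar_path n x y r) (polar_path n x' y' r')"
    and "continuous_on {0..1} r" "\<And>t. t \<in> {0..1} \<Longrightarrow> r t > 0"
    and "continuous_on {0..1} r'" "\<And>t. t \<in> {0..1} \<Longrightarrow> r' t > 0"
  shows "y = y'"
proof -
  have "homotopic_paths (- {0}) (polar_path n x y r) (polar_path n x' y' r')"
    by (rule homotopic_paths_subset[OF hom]) (auto simp: annulus_def)
  from winding_number_homotopic_paths[OF this]
  have "y / real n = y' / real n"
    using winding_number_polar_path assms(3-6) by metis
  then show ?thesis using \<open>n \<ge> 1\<close> by simp
qed

section \<open>Isotopic paths\<close>

lemma isotopic_imp_homotopic_paths: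
  assumes "isotopic_paths g h"
  shows "homotopic_paths annulus g h"
  using assms unfolding isotopic_paths_def homotopic_paths_def
  by (rule homotopic_with_mono) auto

lemma isotopic_pathsD:
  assumes "isotopic_paths g h"
  shows "pathstart h = pathstart g" "pathfinish h = pathfinish g" "simple_path g" "simple_path h"
  using homotopic_with_imp_property[OF assms[unfolded isotopic_paths_def]] by auto

lemma isotopic_paths_trans:
  assumes "isotopic_paths f g" "isotopic_paths g h"
  shows "isotopic_paths f h"
  using homotopic_with_trans[OF assms(1)[unfolded isotopic_paths_def]]
    assms(2)[unfolded isotopic_paths_def isotopic_pathsD(1,2)[OF assms(1)]]
  unfolding isotopic_paths_def .

section \<open>Paths hugging the outer boundary\<close>

definition hugging_depth :: "(real \<Rightarrow> real) \<Rightarrow> bool" where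
  "hugging_depth \<rho> \<longleftrightarrow> continuous_on {0..1} \<rho> \<and> \<rho> 0 = 0 \<and> \<rho> 1 = 0 \<and>
     (\<forall>t\<in>{0<..<1}. 0 < \<rho> t \<and> \<rho> t < 1 / 2)"

lemma hugging_depth_convex:
  assumes "hugging_depth \<rho>" "hugging_depth \<sigma>" "u \<in> {0..1}"
  shows "hugging_depth (\<lambda>t. (1 - u) * \<rho> t + u * \<sigma> t)"
proof -
  have "0 < (1 - u) * \<rho> t + u * \<sigma> t \<and> (1 - u) * \<rho> t + u * \<sigma> t < 1 / 2" if "t \<in> {0<..<1}" for t
  proof -
    have *: "0 < \<rho> t" "\<rho> t < 1 / 2" "0 < \<sigma> t" "\<sigma> t < 1 / 2" "0 \<le> u" "u \<le> 1"
      using assms that unfolding hugging_depth_def by auto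
    then have "(1 - u) * \<rho> t + u * \<sigma> t < 1 / 2"
      by (intro convex_bound_lt) auto
    moreover have "0 < (1 - u) * \<rho> t + u * \<sigma> t"
      using * by (cases "u = 0") (auto intro: add_nonneg_pos)
    ultimately show ?thesis by simp
  qed
  moreover have "continuous_on {0..1} (\<lambda>t. (1 - u) * \<rho> t + u * \<sigma> t)"
    using assms unfolding hugging_depth_def by (intro continuous_intros) auto
  ultimately show ?thesis using assms unfolding hugging_depth_def by auto
qed

text \<open>The depth is relative to the outer radius 2. Hence the bound 1/2 in
  \<open>hugging_depth\<close> keeps the path away from the inner circle.\<close>

definition hugging_path :: "nat \<Rightarrow> int \<Rightarrow> int \<Rightarrow> (real \<Rightarrow> real) \<Rightarrow> real \<Rightarrow> complex" where
  "hugging_path n p s \<rho> = polar_path n (of_int p) (of_int (s - p)) (\<lambda>t. 1 - \<rho> t)"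

lemma hugging_path_ends:
  assumes "hugging_depth \<rho>"
  shows "pathstart (hugging_path n p s \<rho>) = outer_point n (of_int p)"
    and "pathfinish (hugging_path n p s \<rho>) = outer_point n (of_int s)"
  using assms unfolding hugging_depth_def hugging_path_def polar_path_def
  by (simp_all add: pathstart_def pathfinish_def)

lemma hugging_depth_bounds:
  assumes "hugging_depth \<rho>" "t \<in> {0..1}"
  shows "0 \<le> \<rho> t" "\<rho> t < 1 / 2"
proof -
  consider "t = 0" | "t = 1" | "t \<in> {0<..<1}" using assms(2) by force
  then have "0 \<le> \<rho> t \<and> \<rho> t < 1 / 2"
    by cases (use assms(1) in \<open>auto simp: hugging_depth_def intro: less_imp_le\<close>)
  then show "0 \<le> \<rho> t" "\<rho> t < 1 / 2" by auto
qed

lemma norm_hugging_path: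
  assumes "hugging_depth \<rho>" "t \<in> {0..1}"
  shows "norm (hugging_path n p s \<rho> t) = 2 * (1 - \<rho> t)"
  using hugging_depth_bounds[OF assms] unfolding hugging_path_def polar_path_def by simp

lemma hugging_path_in_annulus:
  assumes "hugging_depth \<rho>" "t \<in> {0..1}"
  shows "hugging_path n p s \<rho> t \<in> annulus"
  using norm_hugging_path[OF assms] hugging_depth_bounds[OF assms] by (simp add: annulus_def)

lemma continuous_hugging_path:
  assumes "hugging_depth \<rho>"
  shows "continuous_on {0..1} (hugging_path n p s \<rho>)"
  unfolding hugging_path_def polar_path_def
  using assms unfolding hugging_depth_def by (intro continuous_intros) auto

text \<open>Equal norms force equal depths, so at a double point the angles differ by whole turns.
  The path makes at most one turn, which leaves only its two ends.\<close>

lemma simple_path_hugging_path: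
  assumes "1 \<le> s - p" "s - p \<le> int n" and \<rho>: "hugging_depth \<rho>"
  shows "simple_path (hugging_path n p s \<rho>)"
  unfolding simple_path_def loop_free_def path_def
proof (intro conjI ballI impI continuous_hugging_path[OF \<rho>])
  fix x y :: real
  assume x: "x \<in> {0..1}" and y: "y \<in> {0..1}"
    and eq: "hugging_path n p s \<rho> x = hugging_path n p s \<rho> y"
  have "n \<ge> 1" using assms by linarith
  have \<rho>_eq: "\<rho> x = \<rho> y"
    using arg_cong[OF eq, of norm] norm_hugging_path[OF \<rho>] x y by simp
  have "\<rho> y < 1 / 2" using hugging_depth_bounds[OF \<rho> y] by simp
  then have "outer_point n (of_int p + x * of_int (s - p)) = outer_point n (of_int p + y * of_int (s - p))"
    using eq unfolding hugging_path_def polar_path_def \<rho>_eq by simp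
  then obtain k :: int where "of_int p + x * of_int (s - p) = of_int p + y * of_int (s - p) + real_of_int k * real n"
    using outer_point_eq_iff[OF \<open>n \<ge> 1\<close>] by blast
  then have k: "(x - y) * of_int (s - p) = real_of_int k * real n"
    by (simp add: algebra_simps)
  define d where "d = real_of_int (s - p)"
  have d: "0 < d" "d \<le> real n"
    using assms of_int_le_iff[of "s - p" "int n", where 'a = real] unfolding d_def by auto
  have xy: "\<bar>x - y\<bar> \<le> 1" using x y by auto
  have kd: "(x - y) * d = real_of_int k * real n" using k unfolding d_def .
  show "x = y \<or> x = 0 \<and> y = 1 \<or> x = 1 \<and> y = 0"
  proof (cases "k = 0")
    case True
    then show ?thesis using kd d by simp
  next
    case False
    then have "1 \<le> \<bar>real_of_int k\<bar>" by linarith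
    have "real n \<le> \<bar>real_of_int k\<bar> * real n"
      using \<open>1 \<le> \<bar>real_of_int k\<bar>\<close> by (simp add: mult_le_cancel_right1)
    also have "\<dots> = \<bar>x - y\<bar> * d"
      using kd d by (metis abs_mult abs_of_nat abs_of_pos)
    finally have "d \<le> \<bar>x - y\<bar> * d" using d by linarith
    then have "1 \<le> \<bar>x - y\<bar>" using d by simp
    then show ?thesis using x y by auto
  qed
qed

lemma hugging_path_interior:
  assumes "hugging_depth \<rho>" "t \<in> {0<..<1}"
  shows "hugging_path n p s \<rho> t \<in> interior annulus"
proof -
  have "0 < \<rho> t" "\<rho> t < 1 / 2" using assms unfolding hugging_depth_def by auto
  then show ?thesis
    using norm_hugging_path[OF assms(1), of t] assms(2) by (simp add: interior_annulus)
qed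

text \<open>At each parameter the two paths have the same angle, so interpolating them interpolates
  their depths.\<close>

lemma isotopic_hugging_paths:
  assumes "1 \<le> s - p" "s - p \<le> int n" and \<rho>: "hugging_depth \<rho>" and \<sigma>: "hugging_depth \<sigma>"
  shows "isotopic_paths (hugging_path n p s \<rho>) (hugging_path n p s \<sigma>)"
proof -
  have eq: "(\<lambda>t. (1 - u) *\<^sub>R hugging_path n p s \<rho> t + u *\<^sub>R hugging_path n p s \<sigma> t) =
      hugging_path n p s (\<lambda>t. (1 - u) * \<rho> t + u * \<sigma> t)" for u
    unfolding hugging_path_def polar_path_def by (auto simp: algebra_simps fun_eq_iff)
  have conv: "hugging_depth (\<lambda>t. (1 - u) * \<rho> t + u * \<sigma> t)" if "u \<in> {0..1}" for u
    using hugging_depth_convex[OF \<rho> \<sigma> that] .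
  show ?thesis
    unfolding isotopic_paths_def
  proof (rule homotopic_with_linearI)
    show "(1 - u) *\<^sub>R hugging_path n p s \<rho> t + u *\<^sub>R hugging_path n p s \<sigma> t \<in> annulus"
      if "u \<in> {0..1}" "t \<in> {0..1}" for u t
      unfolding fun_cong[OF eq[of u]]
      using hugging_path_in_annulus[OF conv[OF that(1)] that(2)] .
  qed (auto simp: eq continuous_hugging_path \<rho> \<sigma> conv simple_path_hugging_path assms hugging_path_ends)
qed

text \<open>Reversing a path negates its angle, so for unoriented curves only the absolute value is
  an invariant.\<close>

lemma isotopic_polar_curves_angle_eq:
  assumes "n \<ge> 1" and "isotopic_curves (polar_path n x y r) (polar_path n x' y' r')"
    and r: "continuous_on {0..1} r" "\<And>t. t \<in> {0..1} \<Longrightarrow> r t > 0"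
    and r': "continuous_on {0..1} r'" "\<And>t. t \<in> {0..1} \<Longrightarrow> r' t > 0"
  shows "\<bar>y\<bar> = \<bar>y'\<bar>" and "y = y' \<and> isotopic_paths (polar_path n x y r) (polar_path n x' y' r') \<or> y = - y'"
proof -
  have rev: "reversepath (polar_path n x' y' r') = polar_path n (x' + y') (- y') (\<lambda>t. r' (1 - t))"
    unfolding reversepath_def polar_path_def by (auto simp: fun_eq_iff algebra_simps)
  have cont: "continuous_on {0..1} (\<lambda>t. r' (1 - t))"
    by (rule continuous_on_compose2[OF r'(1)]) (auto intro!: continuous_intros)
  have "y = - y'" if "isotopic_paths (polar_path n x y r) (reversepath (polar_path n x' y' r'))"
    using homotopic_polar_paths_angle_eq[OF assms(1) isotopic_imp_homotopic_paths[OF that[unfolded rev]] r cont] r'(2)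
    by simp
  moreover have "y = y'" if "isotopic_paths (polar_path n x y r) (polar_path n x' y' r')"
    using homotopic_polar_paths_angle_eq[OF assms(1) isotopic_imp_homotopic_paths[OF that] r r'] .
  ultimately show "y = y' \<and> isotopic_paths (polar_path n x y r) (polar_path n x' y' r') \<or> y = - y'"
    using assms(2) unfolding isotopic_curves_def by blast
  then show "\<bar>y\<bar> = \<bar>y'\<bar>" by auto
qed

lemma hugging_radius:
  assumes "hugging_depth \<rho>"
  shows "continuous_on {0..1} (\<lambda>t. 1 - \<rho> t)" "\<And>t. t \<in> {0..1} \<Longrightarrow> 1 - \<rho> t > 0"
proof -
  show "continuous_on {0..1} (\<lambda>t. 1 - \<rho> t)"
    using assms unfolding hugging_depth_def by (intro continuous_intros) simp
  show "1 - \<rho> t > 0" if "t \<in> {0..1}" for t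
    using hugging_depth_bounds(2)[OF assms that] by simp
qed

text \<open>Counted in steps between marked points, the angle is at least 2, whereas a constant path
  has angle 0 and an outer boundary segment angle 1. Inner segments have the wrong
  endpoints.\<close>

lemma finite_curve_hugging_path:
  assumes ps: "2 \<le> s - p" "s - p \<le> int n" and \<rho>: "hugging_depth \<rho>"
  shows "finite_curve n m (hugging_path n p s \<rho>)"
proof -
  have "n \<ge> 1" using ps by linarith
  let ?g = "hugging_path n p s \<rho>"
  note r = hugging_radius[OF \<rho>]
  have d: "real_of_int (s - p) \<ge> 2" using ps(1) by linarith
  have "\<not> homotopic_paths annulus ?g (linepath (pathstart ?g) (pathstart ?g))"
  proof
    have "linepath (pathstart ?g) (pathstart ?g) = polar_path n (of_int p) 0 (\<lambda>_. 1)"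
      unfolding hugging_path_ends[OF \<rho>] linepath_def polar_path_def
      by (auto simp: fun_eq_iff algebra_simps simp flip: scaleR_add_left)
    moreover assume "homotopic_paths annulus ?g (linepath (pathstart ?g) (pathstart ?g))"
    ultimately have "real_of_int (s - p) = 0"
      using homotopic_polar_paths_angle_eq[OF \<open>n \<ge> 1\<close> _ r, of "of_int p" "of_int (s - p)"]
      unfolding hugging_path_def by (metis continuous_on_const zero_less_one)
    with d show False by simp
  qed
  moreover have "\<not> isotopic_curves ?g b" if b: "b \<in> boundary_segments n m" for b
  proof
    assume iso: "isotopic_curves ?g b"
    consider k where "b = (\<lambda>t. 2 * cis (2 * pi * (real k - 1 + t) / real n))"
      | k where "b = (\<lambda>t. cis (2 * pi * (real k - 1 + t) / real m))"
      using b unfolding boundary_segments_def by blast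
    then show False
    proof cases
      case 1
      then have "b = polar_path n (real k) 1 (\<lambda>_. 1)"
        unfolding polar_path_def outer_point_def by (auto simp: fun_eq_iff algebra_simps)
      then have "\<bar>real_of_int (s - p)\<bar> = \<bar>1\<bar>"
        using isotopic_polar_curves_angle_eq(1)[OF \<open>n \<ge> 1\<close> _ r] iso
        unfolding hugging_path_def by (metis continuous_on_const zero_less_one)
      with d show False by simp
    next
      case 2
      then have "norm (pathstart b) = 1" "norm (pathfinish b) = 1"
        by (auto simp: pathstart_def pathfinish_def)
      moreover have "pathstart ?g = pathstart b \<or> pathstart ?g = pathfinish b"
        using iso isotopic_pathsD(1) unfolding isotopic_curves_def by (metis pathstart_reversepath)
      moreover have "norm (pathstart ?g) = 2"
        by (simp add: hugging_path_ends[OF \<rho>])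
      ultimately show False by auto
    qed
  qed
  moreover have "simple_path ?g"
    using simple_path_hugging_path ps \<rho> by simp
  moreover have "?g ` {0<..<1} \<subseteq> interior annulus"
    using hugging_path_interior[OF \<rho>] by auto
  ultimately show ?thesis
    unfolding finite_curve_def using outer_point_in_marked_points[OF \<open>n \<ge> 1\<close>]
    by (simp add: hugging_path_ends[OF \<rho>])
qed

section \<open>Representatives of arcs and where they meet the boundary\<close>

lemma finite_curve_path_image:
  assumes "finite_curve n m g" "w \<in> path_image g"
  shows "w \<in> interior annulus \<or> w = pathstart g \<or> w = pathfinish g"
proof -
  obtain t where t: "t \<in> {0..1}" "w = g t" using assms(2) unfolding path_image_def by auto
  consider "t = 0" | "t = 1" | "t \<in> {0<..<1}" using t(1) by force
  then show ?thesis
  proof cases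
    case 3
    then show ?thesis using assms(1) t(2) unfolding finite_curve_def by blast
  qed (use t(2) in \<open>simp_all add: pathstart_def pathfinish_def\<close>)
qed

lemma marked_points_subset_annulus: "marked_points n m \<subseteq> annulus"
  by (auto elim!: marked_points_cases simp: annulus_def)

lemma isotopic_curves_refl:
  assumes "finite_curve n m g"
  shows "isotopic_curves g g"
proof -
  have "path_image g \<subseteq> annulus"
    using finite_curve_path_image[OF assms] assms interior_subset[of annulus]
      marked_points_subset_annulus unfolding finite_curve_def by blast
  moreover have "simple_path g" using assms unfolding finite_curve_def by simp
  moreover from this have "path g" by (rule simple_path_imp_path)
  ultimately show ?thesis
    unfolding isotopic_curves_def isotopic_paths_def
    by (auto simp: path_def path_image_def)
qed

lemma asymptotic_curveD:
  assumes "asymptotic_curve n m D g" "t \<ge> 0"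
  shows "g t \<in> interior annulus - meridian \<or> t = 0 \<and> g t \<in> marked_points n m"
proof (cases "t = 0")
  case False
  then have "g t \<in> g ` {0<..}" using assms(2) by simp
  then show ?thesis using assms(1) unfolding asymptotic_curve_def by blast
qed (use assms in \<open>simp add: asymptotic_curve_def\<close>)

lemma isotopic_asymptotic_refl:
  assumes "asymptotic_curve n m D g"
  shows "isotopic_asymptotic n m D g g"
proof -
  have "g t \<in> annulus" if "t \<ge> 0" for t
    using asymptotic_curveD[OF assms that] interior_subset[of annulus]
      marked_points_subset_annulus[of n m] by auto
  moreover have "continuous_on {0..} g" using assms unfolding asymptotic_curve_def by simp
  ultimately show ?thesis
    using assms unfolding isotopic_asymptotic_def by (auto simp: image_subset_iff)
qed

lemma arcs_cases:
  assumes "\<alpha> \<in> arcs n m"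
  obtains g where "finite_curve n m g" "\<alpha> = Finite_arc {h. finite_curve n m h \<and> isotopic_curves g h}"
  | g D where "asymptotic_curve n m D g" "\<alpha> = Asymptotic_arc {h. isotopic_asymptotic n m D g h}"
  using assms unfolding arcs_def finite_arcs_def pruefer_arcs_def adic_arcs_def spiralling_arcs_def
  by blast

lemma infdist_meridian_lt:
  assumes "infdist w meridian < e"
  shows "norm w < 3 / 2 + e"
proof -
  have "meridian \<noteq> {}" "closed meridian" by (auto simp: meridian_def)
  then obtain x where "x \<in> meridian" "infdist w meridian = dist w x"
    using infdist_attains_inf by metis
  moreover have "norm w \<le> norm x + dist w x"
    by (metis dist_norm norm_triangle_sub)
  ultimately show ?thesis using assms by (simp add: meridian_def)
qed

text \<open>The image need not be closed, as the curve accumulates at the meridian. Its tail lies in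
  the disc of radius 7/4 = 3/2 + 1/4, well inside the outer circle, and the rest is compact.\<close>

lemma closure_asymptotic_curve:
  assumes g: "asymptotic_curve n m D g" and "norm w = 2" "w \<noteq> g 0"
  shows "w \<notin> closure (g ` {0..})"
proof -
  have "((\<lambda>t. infdist (g t) meridian) \<longlongrightarrow> 0) at_top"
    using g unfolding asymptotic_curve_def by simp
  then have "\<forall>\<^sub>F t in at_top. infdist (g t) meridian < 1 / 4"
    by (rule order_tendstoD) simp
  then obtain N where N: "\<And>t. t \<ge> N \<Longrightarrow> infdist (g t) meridian < 1 / 4"
    by (auto simp: eventually_at_top_linorder)
  have "norm (g t) \<le> 7 / 4" if "t \<ge> N" for t
    using infdist_meridian_lt[OF N[OF that]] by simp
  then have "g t \<in> g ` {0..N} \<union> cball 0 (7 / 4)" if "t \<ge> 0" for t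
    using that by (cases "t \<le> N") auto
  then have sub: "g ` {0..} \<subseteq> g ` {0..N} \<union> cball 0 (7 / 4)"
    by blast
  have "continuous_on {0..} g" using g unfolding asymptotic_curve_def by simp
  then have "continuous_on {0..N} g" by (rule continuous_on_subset) auto
  then have "compact (g ` {0..N})"
    by (rule compact_continuous_image) simp
  then have "closed (g ` {0..N} \<union> cball 0 (7 / 4))"
    by (intro closed_Un compact_imp_closed) auto
  then have "closure (g ` {0..}) \<subseteq> g ` {0..N} \<union> cball 0 (7 / 4)"
    using sub by (rule closure_minimal[rotated])
  moreover have "w \<notin> g ` {0..N}"
    using asymptotic_curveD[OF g] assms(2,3) by (force simp: interior_annulus)
  moreover have "w \<notin> cball 0 (7 / 4)" using assms(2) by simp
  ultimately show ?thesis by auto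
qed

text \<open>
  At each angle the path stays closer to the boundary than \<open>X\<close> does. This works for arbitrarily
  wild \<open>X\<close>, also if \<open>X\<close> contains endpoints of the path.
\<close>

lemma hugging_path_avoiding:
  assumes "p < s" "X \<noteq> {}"
    and X: "\<And>x. of_int p < x \<Longrightarrow> x < of_int s \<Longrightarrow> outer_point n x \<notin> closure X"
  obtains \<rho> where "hugging_depth \<rho>"
    "path_image (hugging_path n p s \<rho>) \<inter> X \<subseteq> {outer_point n (of_int p), outer_point n (of_int s)}"
proof -
  define P where "P t = outer_point n (of_int p + t * of_int (s - p))" for t
  \<comment> \<open>The first term makes the depth vanish at both ends. By the second,
    \<open>P t\<close> moves by \<open>2 * \<rho> t\<close>, at most half its distance from
    \<open>X\<close>.\<close>
  define \<rho> where "\<rho> t = min (t * (1 - t)) (infdist (P t) X / 4)" for t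
  have quarter: "t * (1 - t) < 1 / 2" for t :: real
    using zero_le_power2[of "t - 1 / 2"] by (simp add: power2_eq_square algebra_simps)
  have pos: "infdist (P t) X > 0" if "t \<in> {0<..<1}" for t
  proof -
    have "0 < t * of_int (s - p)" "t * of_int (s - p) < of_int (s - p)"
      using that \<open>p < s\<close> by auto
    then have "P t \<notin> closure X"
      unfolding P_def by (intro X) auto
    then show ?thesis
      using in_closure_iff_infdist_zero[OF \<open>X \<noteq> {}\<close>] infdist_nonneg[of "P t" X] by force
  qed
  have "continuous_on {0..1} \<rho>"
    unfolding \<rho>_def P_def by (intro continuous_intros) auto
  moreover have "0 < \<rho> t \<and> \<rho> t < 1 / 2" if "t \<in> {0<..<1}" for t
    using pos[OF that] that quarter[of t] unfolding \<rho>_def by (auto simp: min_less_iff_disj)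
  ultimately have depth: "hugging_depth \<rho>"
    unfolding hugging_depth_def \<rho>_def by (auto simp: infdist_nonneg)
  have "hugging_path n p s \<rho> t \<notin> X" if "t \<in> {0<..<1}" for t
  proof
    assume "hugging_path n p s \<rho> t \<in> X"
    then have "infdist (P t) X \<le> dist (P t) (hugging_path n p s \<rho> t)"
      by (rule infdist_le)
    also have "P t - hugging_path n p s \<rho> t = \<rho> t *\<^sub>R P t"
      unfolding hugging_path_def polar_path_def P_def by (simp add: algebra_simps)
    then have "dist (P t) (hugging_path n p s \<rho> t) = \<bar>\<rho> t\<bar> * 2"
      unfolding dist_norm P_def by simp
    also have "\<dots> \<le> infdist (P t) X / 2"
      using hugging_depth_bounds(1)[OF depth, of t] that by (auto simp: \<rho>_def)
    finally show False using pos[OF that] by simp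
  qed
  then have "path_image (hugging_path n p s \<rho>) \<inter> X \<subseteq>
      {pathstart (hugging_path n p s \<rho>), pathfinish (hugging_path n p s \<rho>)}"
    unfolding path_image_def pathstart_def pathfinish_def
    by (force simp: less_le)
  then show ?thesis using that depth hugging_path_ends[OF depth] by metis
qed

section \<open>Ears as arcs of the annulus\<close>

definition ear :: "nat \<Rightarrow> nat \<Rightarrow> int \<Rightarrow> int \<Rightarrow> annulus_arc" where
  "ear n m p s = Finite_arc {h. finite_curve n m h \<and>
     isotopic_curves (hugging_path n p s (\<lambda>t. t * (1 - t))) h}"

lemma hugging_depth_parabola: "hugging_depth (\<lambda>t. t * (1 - t))"
proof -
  have "t * (1 - t) < 1 / 2" for t :: real
    using zero_le_power2[of "t - 1 / 2"] by (simp add: power2_eq_square algebra_simps)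
  then show ?thesis
    unfolding hugging_depth_def by (auto intro!: continuous_intros)
qed

lemma ear_in_arcs:
  assumes "2 \<le> s - p" "s - p \<le> int n"
  shows "ear n m p s \<in> arcs n m"
  using finite_curve_hugging_path[OF assms hugging_depth_parabola]
  unfolding arcs_def finite_arcs_def ear_def by auto

text \<open>The parabola in \<open>ear\<close> is only a reference depth; the ear may be drawn as
  close to the boundary as desired.\<close>

lemma path_image_in_traces_ear:
  assumes ps: "2 \<le> s - p" "s - p \<le> int n" and "hugging_depth \<rho>"
  shows "path_image (hugging_path n p s \<rho>) \<in> traces (ear n m p s)"
  using finite_curve_hugging_path[OF assms]
    isotopic_hugging_paths[OF _ ps(2) hugging_depth_parabola assms(3)] ps
  unfolding ear_def isotopic_curves_def by auto

lemma num_ends_ear: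
  assumes ps: "2 \<le> s - p" "s - p \<le> int n"
  shows "num_ends (outer_point n (of_int i)) (ear n m p s) =
    of_bool (int n dvd i - p) + of_bool (int n dvd i - s)"
proof -
  have "n \<ge> 1" using ps by linarith
  define g where "g = hugging_path n p s (\<lambda>t. t * (1 - t))"
  define C where "C = {h. finite_curve n m h \<and> isotopic_curves g h}"
  have ear: "ear n m p s = Finite_arc C"
    unfolding ear_def C_def g_def ..
  have "finite_curve n m g"
    unfolding g_def by (rule finite_curve_hugging_path[OF ps hugging_depth_parabola])
  then have g: "g \<in> C" unfolding C_def using isotopic_curves_refl by blast
  have gs: "pathstart g = outer_point n (of_int p)" "pathfinish g = outer_point n (of_int s)"
    unfolding g_def using hugging_path_ends[OF hugging_depth_parabola] by auto
  have h: "pathstart h = pathstart g \<and> pathfinish h = pathfinish g \<or>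
      pathstart h = pathfinish g \<and> pathfinish h = pathstart g" if "h \<in> C" for h
    using that isotopic_pathsD(1,2)[of g h] isotopic_pathsD(1,2)[of g "reversepath h"]
    unfolding C_def isotopic_curves_def by auto
  let ?w = "outer_point n (of_int i)"
  have eqs: "pathstart g = ?w \<longleftrightarrow> int n dvd i - p" "pathfinish g = ?w \<longleftrightarrow> int n dvd i - s"
    unfolding gs using outer_point_int_eq_iff[OF \<open>n \<ge> 1\<close>] by (metis dvd_diff_commute)+
  have "(\<exists>h\<in>C. pathstart h = ?w \<and> pathfinish h = ?w) \<longleftrightarrow> pathstart g = ?w \<and> pathfinish g = ?w"
    using g h by metis
  moreover have "(\<exists>h\<in>C. pathstart h = ?w \<or> pathfinish h = ?w) \<longleftrightarrow> pathstart g = ?w \<or> pathfinish g = ?w"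
    using g h by metis
  ultimately show ?thesis
    unfolding ear num_ends.simps by (simp add: eqs)
qed

text \<open>Both angles are positive, so the isotopy cannot reverse the orientation. Equal angles
  and equal starting points then leave only a common translation.\<close>

lemma ear_eqD:
  assumes ps: "2 \<le> s - p" "s - p \<le> int n" and ps': "2 \<le> s' - p'" "s' - p' \<le> int n"
    and eq: "ear n m p s = ear n m p' s'"
  shows "\<exists>k. p' = p + k * int n \<and> s' = s + k * int n"
proof -
  have "n \<ge> 1" using ps by linarith
  let ?r = "\<lambda>t::real. t * (1 - t)"
  let ?g = "hugging_path n p s ?r" and ?g' = "hugging_path n p' s' ?r"
  note r = hugging_radius[OF hugging_depth_parabola]
  have "finite_curve n m ?g'"
    by (rule finite_curve_hugging_path[OF ps' hugging_depth_parabola])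
  then have "isotopic_curves ?g ?g'"
    using isotopic_curves_refl eq unfolding ear_def by blast
  then have *: "real_of_int (s - p) = real_of_int (s' - p') \<and> isotopic_paths ?g ?g' \<or>
      real_of_int (s - p) = - real_of_int (s' - p')"
    using isotopic_polar_curves_angle_eq(2)[OF \<open>n \<ge> 1\<close> _ r r]
    unfolding hugging_path_def by blast
  have "real_of_int (s - p) > 0" "real_of_int (s' - p') > 0"
    using ps(1) ps'(1) by linarith+
  with * have d: "s - p = s' - p'" and iso: "isotopic_paths ?g ?g'"
    using of_int_eq_iff[of "s - p" "s' - p'", where 'a = real] by linarith+
  from isotopic_pathsD(1)[OF iso] have "int n dvd p' - p"
    using hugging_path_ends[OF hugging_depth_parabola] outer_point_int_eq_iff[OF \<open>n \<ge> 1\<close>] by metis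
  then obtain k where "p' - p = int n * k" by (rule dvdE)
  with d show ?thesis by (intro exI[of _ k]) (auto simp: algebra_simps)
qed

section \<open>Compatibility of ears with other arcs\<close>

lemma compatible_sym: "compatible n m \<alpha> \<beta> \<Longrightarrow> compatible n m \<beta> \<alpha>"
  unfolding compatible_def by blast

lemma marked_outer_point_int:
  assumes "n \<ge> 1" "outer_point n x \<in> marked_points n m"
  obtains i where "x = of_int i"
  using assms(2)
proof (cases rule: marked_points_cases)
  case (1 i)
  then obtain k :: int where "x = of_int i + of_int k * real n"
    using outer_point_eq_iff[OF assms(1)] by blast
  then show ?thesis using that[of "i + k * int n"] by simp
qed simp

text \<open>The closure matters: only a positive distance from the curve leaves room for an ear
  below it.\<close>

lemma arc_avoiding_outer_boundary:
  assumes "n \<ge> 1" and \<beta>: "\<beta> \<in> arcs n m"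
  obtains X where "X \<in> traces \<beta>" "X \<noteq> {}"
    "\<And>x. outer_point n x \<in> closure X \<Longrightarrow> \<exists>i. x = of_int i \<and> num_ends (outer_point n x) \<beta> \<noteq> 0"
  using \<beta>
proof (cases rule: arcs_cases)
  case (1 g)
  define C where "C = {h. finite_curve n m h \<and> isotopic_curves g h}"
  have \<beta>_eq: "\<beta> = Finite_arc C" using 1 C_def by simp
  have gC: "g \<in> C" unfolding C_def using 1(1) isotopic_curves_refl by blast
  show ?thesis
  proof (rule that[of "path_image g"])
    show "path_image g \<in> traces \<beta>" using gC \<beta>_eq by simp
    fix x assume "outer_point n x \<in> closure (path_image g)"
    moreover have "closed (path_image g)"
      using 1(1) unfolding finite_curve_def by (simp add: closed_simple_path_image)
    ultimately have x: "outer_point n x = pathstart g \<or> outer_point n x = pathfinish g"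
      using finite_curve_path_image[OF 1(1), of "outer_point n x"] by (simp add: interior_annulus)
    then have "num_ends (outer_point n x) \<beta> \<noteq> 0"
      using gC \<beta>_eq by auto
    moreover have "outer_point n x \<in> marked_points n m"
      using x 1(1) unfolding finite_curve_def by auto
    ultimately show "\<exists>i. x = of_int i \<and> num_ends (outer_point n x) \<beta> \<noteq> 0"
      using marked_outer_point_int[OF \<open>n \<ge> 1\<close>] by metis
  qed simp
next
  case (2 g D)
  define C where "C = {h. isotopic_asymptotic n m D g h}"
  have \<beta>_eq: "\<beta> = Asymptotic_arc C" using 2 C_def by simp
  have gC: "g \<in> C" unfolding C_def using isotopic_asymptotic_refl[OF 2(1)] by simp
  show ?thesis
  proof (rule that[of "g ` {0..}"])
    show "g ` {0..} \<in> traces \<beta>" using gC \<beta>_eq by simp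
    fix x assume "outer_point n x \<in> closure (g ` {0..})"
    then have x: "outer_point n x = g 0"
      using closure_asymptotic_curve[OF 2(1)] norm_outer_point by blast
    then have "num_ends (outer_point n x) \<beta> \<noteq> 0"
      using gC \<beta>_eq by auto
    moreover have "outer_point n x \<in> marked_points n m"
      using x 2(1) unfolding asymptotic_curve_def by simp
    ultimately show "\<exists>i. x = of_int i \<and> num_ends (outer_point n x) \<beta> \<noteq> 0"
      using marked_outer_point_int[OF \<open>n \<ge> 1\<close>] by metis
  qed simp
qed

text \<open>The representative of \<beta> stays fixed; the ear is pushed between it and the
  boundary.\<close>

lemma compatible_ear:
  assumes ps: "2 \<le> s - p" "s - p \<le> int n" and \<beta>: "\<beta> \<in> arcs n m"
    and no_ends: "\<And>i. p < i \<Longrightarrow> i < s \<Longrightarrow> num_ends (outer_point n (of_int i)) \<beta> = 0"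
  shows "compatible n m (ear n m p s) \<beta>"
proof -
  have "n \<ge> 1" using ps by linarith
  obtain X where X: "X \<in> traces \<beta>" "X \<noteq> {}"
    "\<And>x. outer_point n x \<in> closure X \<Longrightarrow> \<exists>i. x = of_int i \<and> num_ends (outer_point n x) \<beta> \<noteq> 0"
    using arc_avoiding_outer_boundary[OF \<open>n \<ge> 1\<close> \<beta>] by blast
  have "outer_point n x \<notin> closure X" if "of_int p < x" "x < of_int s" for x
    using X(3)[of x] no_ends that by force
  then obtain \<rho> where "hugging_depth \<rho>"
    "path_image (hugging_path n p s \<rho>) \<inter> X \<subseteq> {outer_point n (of_int p), outer_point n (of_int s)}"
    using hugging_path_avoiding[of p s X n] X(2) ps(1) by force
  then show ?thesis
    unfolding compatible_def
    using X(1) path_image_in_traces_ear[OF ps] outer_point_in_marked_points[OF \<open>n \<ge> 1\<close>] by blast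
qed

section \<open>Spirals and maximality\<close>

text \<open>The radius factor falls from 1 to 3/4, that is, from the outer circle towards the
  meridian of radius 3/2. It is strictly monotone, which gives injectivity.\<close>

definition spiral :: "nat \<Rightarrow> int \<Rightarrow> real \<Rightarrow> complex" where
  "spiral n p = polar_path n (of_int p) 1 (\<lambda>t. 3 / 4 + 1 / (4 * (1 + t)))"

definition spiral_arc :: "nat \<Rightarrow> nat \<Rightarrow> int \<Rightarrow> annulus_arc" where
  "spiral_arc n m p = Asymptotic_arc {h. isotopic_asymptotic n m at_top (spiral n p) h}"

lemma norm_spiral: "t \<ge> 0 \<Longrightarrow> norm (spiral n p t) = 3 / 2 + 1 / (2 * (1 + t))"
  unfolding spiral_def polar_path_def by (simp add: field_simps)

lemma asymptotic_curve_spiral: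
  assumes "n \<ge> 1"
  shows "asymptotic_curve n m at_top (spiral n p)"
  unfolding asymptotic_curve_def
proof (intro conjI)
  show "continuous_on {0..} (spiral n p)"
    unfolding spiral_def polar_path_def by (intro continuous_intros) auto
  show "inj_on (spiral n p) {0..}"
  proof (rule inj_onI)
    fix x y :: real assume *: "x \<in> {0..}" "y \<in> {0..}" "spiral n p x = spiral n p y"
    then have "3 / 2 + 1 / (2 * (1 + x)) = 3 / 2 + 1 / (2 * (1 + y))"
      using norm_spiral[of x n p] norm_spiral[of y n p] by (metis atLeast_iff)
    then have "2 * (1 + x) = 2 * (1 + y)"
      by (metis add_left_cancel divide_inverse inverse_eq_iff_eq mult_1)
    then show "x = y" by simp
  qed
  show "spiral n p 0 \<in> marked_points n m"
    using outer_point_in_marked_points[OF assms] by (simp add: spiral_def polar_path_def)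
  have "spiral n p t \<in> interior annulus - meridian" if "t > 0" for t
  proof -
    define e where "e = 1 / (2 * (1 + t))"
    have "0 < e" "e < 1 / 2" using that unfolding e_def by (auto simp: field_simps)
    moreover have "norm (spiral n p t) = 3 / 2 + e"
      unfolding e_def using norm_spiral[of t n p] that by simp
    ultimately show ?thesis
      by (simp add: interior_annulus meridian_def)
  qed
  then show "spiral n p ` {0<..} \<subseteq> interior annulus - meridian" by auto
  show "((\<lambda>t. infdist (spiral n p t) meridian) \<longlongrightarrow> 0) at_top"
  proof (rule tendsto_sandwich[where f = "\<lambda>_. 0" and h = "\<lambda>t. 1 / (2 * (1 + t))"])
    show "\<forall>\<^sub>F t in at_top. infdist (spiral n p t) meridian \<le> 1 / (2 * (1 + t))"
    proof (rule eventually_mono[OF eventually_ge_at_top[of 0]])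
      fix t :: real assume t: "t \<ge> 0"
      \<comment> \<open>The radial projection to the meridian.\<close>
      let ?w = "(3 / 4) *\<^sub>R outer_point n (of_int p + t)"
      have "?w \<in> meridian" by (simp add: meridian_def)
      then have "infdist (spiral n p t) meridian \<le> dist (spiral n p t) ?w"
        by (rule infdist_le)
      also have "\<dots> = 1 / (2 * (1 + t))"
        using t unfolding dist_norm spiral_def polar_path_def
        by (simp flip: scaleR_left_diff_distrib) (simp add: field_simps)
      finally show "infdist (spiral n p t) meridian \<le> 1 / (2 * (1 + t))" .
    qed
    show "((\<lambda>t::real. 1 / (2 * (1 + t))) \<longlongrightarrow> 0) at_top" by real_asymp
  qed (auto simp: infdist_nonneg)
  define \<theta> where "\<theta> t = 2 * pi * (of_int p + t - 1) / real n" for t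
  have "spiral n p t = of_real (norm (spiral n p t)) * cis (\<theta> t)" if "t \<ge> 0" for t
  proof -
    define r where "r = 3 / 4 + 1 / (4 * (1 + t))"
    have "r > 0" using that unfolding r_def by (intro add_pos_nonneg) auto
    moreover have "spiral n p t = r *\<^sub>R outer_point n (of_int p + t)"
      unfolding spiral_def polar_path_def r_def by simp
    ultimately show ?thesis
      unfolding \<theta>_def by (simp add: outer_point_def scaleR_conv_of_real norm_mult)
  qed
  moreover have "continuous_on {0..} \<theta>"
    unfolding \<theta>_def using assms by (intro continuous_intros) auto
  moreover have "filterlim \<theta> at_top at_top"
    unfolding \<theta>_def using assms by real_asymp
  ultimately show "\<exists>\<theta>. continuous_on {0..} \<theta> \<and>
          (\<forall>t\<ge>0. spiral n p t = of_real (norm (spiral n p t)) * cis (\<theta> t)) \<and>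
          filterlim \<theta> at_top at_top"
    by blast
qed

lemma spiral_arc_in_arcs: "n \<ge> 1 \<Longrightarrow> spiral_arc n m p \<in> arcs n m"
  using asymptotic_curve_spiral
  unfolding arcs_def pruefer_arcs_def spiralling_arcs_def spiral_arc_def by blast

lemma num_ends_spiral_arc:
  assumes "n \<ge> 1"
  shows "num_ends (outer_point n (of_int i)) (spiral_arc n m p) = of_bool (int n dvd i - p)"
proof -
  let ?C = "{h. isotopic_asymptotic n m at_top (spiral n p) h}"
  have "spiral n p \<in> ?C"
    using isotopic_asymptotic_refl[OF asymptotic_curve_spiral[OF assms]] by simp
  moreover have "h 0 = spiral n p 0" if "h \<in> ?C" for h
    using that homotopic_with_imp_property[of _ _ _ "spiral n p" h] unfolding isotopic_asymptotic_def by blast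
  moreover have "spiral n p 0 = outer_point n (of_int p)"
    by (simp add: spiral_def polar_path_def)
  ultimately have "(\<exists>h\<in>?C. h 0 = outer_point n (of_int i)) \<longleftrightarrow>
      outer_point n (of_int p) = outer_point n (of_int i)"
    by metis
  then show ?thesis
    unfolding spiral_arc_def num_ends.simps
    using outer_point_int_eq_iff[OF assms] dvd_diff_commute by (metis of_bool_def)
qed

text \<open>For \<open>u = 1\<close> this moves the annulus radially into the part inside the meridian.\<close>

definition radial_squeeze :: "real \<Rightarrow> complex \<Rightarrow> complex" where
  "radial_squeeze u w = (1 - u / 2 + u / (2 * norm w)) *\<^sub>R w"

text \<open>The radius undergoes an increasing affine map that fixes 1; for \<open>u = 1\<close> it
  sends 2 to 3/2.\<close>

lemma norm_radial_squeeze: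
  assumes "u \<in> {0..1}" "w \<noteq> 0"
  shows "norm (radial_squeeze u w) = (1 - u / 2) * norm w + u / 2"
proof -
  have "0 \<le> 1 - u / 2 + u / (2 * norm w)" using assms by auto
  then show ?thesis
    unfolding radial_squeeze_def using assms by (simp add: field_simps)
qed

lemma radial_squeeze_inj:
  assumes u: "u \<in> {0..1}" and "w \<noteq> 0" "z \<noteq> 0" and eq: "radial_squeeze u w = radial_squeeze u z"
  shows "w = z"
proof -
  have "(1 - u / 2) * norm w = (1 - u / 2) * norm z"
    using arg_cong[OF eq, of norm] norm_radial_squeeze[OF u] assms(2,3) by simp
  then have n: "norm w = norm z" using u by simp
  have "1 - u / 2 + u / (2 * norm z) > 0"
    using u assms(3) by (intro add_pos_nonneg) auto
  then show ?thesis using eq unfolding radial_squeeze_def n by simp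
qed

lemma radial_squeeze_norm_1: "norm w = 1 \<Longrightarrow> radial_squeeze u w = w"
  by (simp add: radial_squeeze_def)

text \<open>A curve with both ends on the inner circle may still wander beyond the meridian and meet
  a spiral; squeezing gives an isotopic one that does not.\<close>

lemma squeeze_inner_curve:
  assumes g: "finite_curve n m g" and ends: "norm (pathstart g) = 1" "norm (pathfinish g) = 1"
  obtains h where "finite_curve n m h" "isotopic_curves g h"
    "\<And>w. w \<in> path_image h \<Longrightarrow> norm w < 3 / 2"
proof -
  have bounds: "1 \<le> norm w \<and> norm w < 2" if "w \<in> path_image g" for w
    using finite_curve_path_image[OF g that] ends by (auto simp: interior_annulus)
  have g_bounds: "1 \<le> norm (g t)" "norm (g t) < 2" "g t \<noteq> 0" if "t \<in> {0..1}" for t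
    using bounds[of "g t"] that by (auto simp: path_image_def)
  have simple: "simple_path g" and cont: "continuous_on {0..1} g"
    using g simple_path_imp_path unfolding finite_curve_def path_def by auto
  have cont_u: "continuous_on {0..1} (\<lambda>t. radial_squeeze u (g t))" for u
    unfolding radial_squeeze_def using cont g_bounds by (intro continuous_intros) auto
  define h where "h t = radial_squeeze 1 (g t)" for t
  \<comment> \<open>The squeezing factor is affine in \<open>u\<close>, so the straight-line
    homotopy passes exactly through the intermediate squeezes.\<close>
  have eq: "(1 - u) *\<^sub>R g t + u *\<^sub>R h t = radial_squeeze u (g t)" for u t
  proof -
    have "1 - u + u * (1 - 1 / 2 + 1 / (2 * norm (g t))) = 1 - u / 2 + u / (2 * norm (g t))"
      by (simp add: algebra_simps)
    then show ?thesis
      unfolding h_def radial_squeeze_def by (metis scaleR_left.add scaleR_scaleR)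
  qed
  have iso: "isotopic_paths g h"
    unfolding isotopic_paths_def
  proof (rule homotopic_with_linearI, unfold eq)
    show "continuous_on {0..1} g" by (rule cont)
    show "continuous_on {0..1} h" unfolding h_def by (rule cont_u)
    fix u :: real assume u: "u \<in> {0..1}"
    show "radial_squeeze u (g t) \<in> annulus" if "t \<in> {0..1}" for t
    proof -
      have "(1 - u / 2) * 1 \<le> (1 - u / 2) * norm (g t)" "(1 - u / 2) * norm (g t) \<le> (1 - u / 2) * 2"
        using u g_bounds[OF that] by (intro mult_left_mono; simp)+
      then show ?thesis
        using u unfolding annulus_def mem_Collect_eq norm_radial_squeeze[OF u g_bounds(3)[OF that]]
        by (simp add: algebra_simps)
    qed
    have "simple_path (\<lambda>t. radial_squeeze u (g t))"
      using simple cont_u[of u] radial_squeeze_inj[OF u g_bounds(3) g_bounds(3)]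
      unfolding simple_path_def loop_free_def path_def by metis
    then show "simple_path (\<lambda>t. radial_squeeze u (g t)) \<and>
        pathstart (\<lambda>t. radial_squeeze u (g t)) = pathstart g \<and>
        pathfinish (\<lambda>t. radial_squeeze u (g t)) = pathfinish g"
      using ends unfolding pathstart_def pathfinish_def by (simp add: radial_squeeze_norm_1)
  qed
  have h_norm: "norm (h t) = (norm (g t) + 1) / 2" if "t \<in> {0..1}" for t
    unfolding h_def using norm_radial_squeeze[of 1 "g t"] g_bounds[OF that] by simp
  have hom: "homotopic_paths annulus g h"
    by (rule isotopic_imp_homotopic_paths[OF iso])
  note isoD = isotopic_pathsD[OF iso]
  have "finite_curve n m h"
    unfolding finite_curve_def isoD(1,2)
  proof (intro conjI ballI)
    show "h ` {0<..<1} \<subseteq> interior annulus"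
    proof
      fix w assume "w \<in> h ` {0<..<1}"
      then obtain t where t: "t \<in> {0<..<1}" "w = h t" by blast
      then have "g t \<in> interior annulus" using g unfolding finite_curve_def by auto
      then show "w \<in> interior annulus"
        using t h_norm[of t] by (simp add: interior_annulus)
    qed
    show "\<not> homotopic_paths annulus h (linepath (pathstart g) (pathstart g))"
      using g homotopic_paths_trans[OF hom] unfolding finite_curve_def by blast
    show "\<not> isotopic_curves h b" if "b \<in> boundary_segments n m" for b
      using g that isotopic_paths_trans[OF iso] unfolding finite_curve_def isotopic_curves_def by blast
  qed (use isoD g in \<open>auto simp: finite_curve_def\<close>)
  moreover have "isotopic_curves g h" using iso unfolding isotopic_curves_def by simp
  moreover have "norm w < 3 / 2" if "w \<in> path_image h" for w
    using that h_norm g_bounds unfolding path_image_def by force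
  ultimately show ?thesis using that by blast
qed

text \<open>By the intermediate value theorem a curve that avoids the meridian stays on its side.
  Asymptotic curves thus need no squeezing.\<close>

lemma asymptotic_curve_inside:
  assumes g: "asymptotic_curve n m D g" and "norm (g 0) = 1" "t \<ge> 0"
  shows "norm (g t) < 3 / 2"
proof (rule ccontr)
  assume "\<not> norm (g t) < 3 / 2"
  moreover have "continuous_on {0..} g" using g unfolding asymptotic_curve_def by simp
  then have "continuous_on {0..t} g" by (rule continuous_on_subset) auto
  then have "continuous_on {0..t} (\<lambda>t. norm (g t))"
    by (rule continuous_on_norm)
  ultimately obtain x where x: "0 \<le> x" "norm (g x) = 3 / 2"
    using IVT'[of "\<lambda>t. norm (g t)" 0 "3 / 2" t] assms by auto
  then have "g x \<in> meridian" by (simp add: meridian_def)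
  then have "x = 0" using asymptotic_curveD[OF g x(1)] by auto
  then show False using x assms(2) by simp
qed

text \<open>The meridian separates the two: the spiral stays outside, and an arc without outer ends
  has a representative inside.\<close>

lemma compatible_spiral_arc:
  assumes "n \<ge> 1" and \<beta>: "\<beta> \<in> arcs n m"
    and no_ends: "\<And>i. num_ends (outer_point n (of_int i)) \<beta> = 0"
  shows "compatible n m (spiral_arc n m p) \<beta>"
proof -
  have "\<exists>Y \<in> traces \<beta>. \<forall>w\<in>Y. norm w < 3 / 2"
    using \<beta>
  proof (cases rule: arcs_cases)
    case (1 g)
    define C where "C = {h. finite_curve n m h \<and> isotopic_curves g h}"
    have \<beta>_eq: "\<beta> = Finite_arc C" using 1 C_def by simp
    have gC: "g \<in> C" unfolding C_def using 1(1) isotopic_curves_refl by blast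
    have "pathstart g \<noteq> outer_point n (of_int i)" "pathfinish g \<noteq> outer_point n (of_int i)" for i
      using no_ends[of i] gC unfolding \<beta>_eq by (auto split: if_splits)
    then have "norm (pathstart g) = 1" "norm (pathfinish g) = 1"
      using 1(1) marked_points_cases unfolding finite_curve_def by metis+
    from squeeze_inner_curve[OF 1(1) this] show ?thesis
      unfolding \<beta>_eq C_def traces.simps by (metis (mono_tags, lifting) image_eqI mem_Collect_eq)
  next
    case (2 g D)
    define C where "C = {h. isotopic_asymptotic n m D g h}"
    have \<beta>_eq: "\<beta> = Asymptotic_arc C" using 2 C_def by simp
    have gC: "g \<in> C" unfolding C_def using isotopic_asymptotic_refl[OF 2(1)] by simp
    have "g 0 \<noteq> outer_point n (of_int i)" for i
      using no_ends[of i] gC unfolding \<beta>_eq by (auto split: if_splits)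
    then have "norm (g 0) = 1"
      using 2(1) marked_points_cases unfolding asymptotic_curve_def by metis
    then have "\<forall>w\<in>g ` {0..}. norm w < 3 / 2"
      using asymptotic_curve_inside[OF 2(1)] by auto
    then show ?thesis using gC unfolding \<beta>_eq by auto
  qed
  then obtain Y where Y: "Y \<in> traces \<beta>" "\<And>w. w \<in> Y \<Longrightarrow> norm w < 3 / 2" by blast
  have "spiral n p ` {0..} \<inter> Y = {}"
    using norm_spiral Y(2) by (force simp: not_less)
  moreover have "spiral n p ` {0..} \<in> traces (spiral_arc n m p)"
    using isotopic_asymptotic_refl[OF asymptotic_curve_spiral[OF \<open>n \<ge> 1\<close>]]
    unfolding spiral_arc_def by simp
  ultimately show ?thesis
    unfolding compatible_def using Y(1) by blast
qed

section \<open>From triangulations to the combinatorial reduction\<close>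

lemma ear_system_triangulation:
  assumes n: "n \<ge> 1" and T: "annulus_triangulation n m T"
    and a: "outer_quiddity_sequence n m T a"
  shows "ear_system n T (\<lambda>i. num_ends (outer_point n (of_int i))) (ear n m)"
proof -
  have T_arcs: "\<beta> \<in> arcs n m" if "\<beta> \<in> T" for \<beta>
    using T that unfolding annulus_triangulation_def by blast
  have maximal: "\<alpha> \<in> T"
    if "\<alpha> \<in> arcs n m" "\<And>\<beta>. \<beta> \<in> T \<Longrightarrow> compatible n m \<alpha> \<beta>" for \<alpha>
  proof -
    have "T \<subseteq> arcs n m" "pairwise (compatible n m) T"
      and max: "\<And>T'. T \<subseteq> T' \<Longrightarrow> T' \<subseteq> arcs n m \<Longrightarrow> pairwise (compatible n m) T' \<Longrightarrow> T' = T"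
      using T unfolding annulus_triangulation_def by simp_all
    then have "pairwise (compatible n m) (insert \<alpha> T)"
      using that(2) compatible_sym[OF that(2)] by (simp add: pairwise_insert)
    then have "insert \<alpha> T = T"
      using \<open>T \<subseteq> arcs n m\<close> that(1) by (intro max) auto
    then show ?thesis by blast
  qed
  show ?thesis
  proof
    show "1 \<le> n" by (rule n)
    show "num_ends (outer_point n (of_int (i + k * int n))) \<alpha> = num_ends (outer_point n (of_int i)) \<alpha>"
      for i k \<alpha>
      using outer_point_shift[OF n, of "of_int i" k] by simp
    \<comment> \<open>Finiteness is part of the assumption that \<open>a\<close> is the quiddity
      sequence.\<close>
    show "finite {\<alpha> \<in> T. num_ends (outer_point n (of_int i)) \<alpha> \<noteq> 0}" for i
    proof -
      define k where "k = nat ((i - 1) mod int n) + 1"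
      have "0 \<le> (i - 1) mod int n" "(i - 1) mod int n < int n" using n by simp_all
      then have "k \<in> {1..n}" unfolding k_def by auto
      moreover from this have "marked_point n m k = outer_point n (of_int i)"
        using outer_point_int_eq_nat[OF n, of i]
        by (simp only: marked_point_outer atLeastAtMost_iff k_def)
      ultimately show ?thesis
        using a unfolding outer_quiddity_sequence_def Let_def by metis
    qed
  next
    fix p s :: int
    assume ps: "2 \<le> s - p" "s - p \<le> int n"
      and "\<And>\<beta>. \<beta> \<in> T \<Longrightarrow>
        (\<forall>i. p < i \<and> i < s \<longrightarrow> num_ends (outer_point n (of_int i)) \<beta> = 0) \<or>
        (\<exists>p' s'. \<beta> = ear n m p' s' \<and> 2 \<le> s' - p' \<and> s' - p' \<le> int n \<and>
          (\<forall>i. p' < i \<and> i < s' \<longrightarrow> num_ends (outer_point n (of_int i)) (ear n m p s) = 0))"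
    \<comment> \<open>In the second alternative the roles are exchanged: \<beta> is the ear that is
      pushed below \<open>ear n m p s\<close>.\<close>
    then show "ear n m p s \<in> T"
      using compatible_ear[OF ps T_arcs] compatible_sym compatible_ear[OF _ _ ear_in_arcs[OF ps]]
      by (intro maximal ear_in_arcs[OF ps]) metis
  next
    fix p :: int
    assume *: "\<And>\<beta>. \<beta> \<in> T \<Longrightarrow> (\<forall>i. num_ends (outer_point n (of_int i)) \<beta> = 0) \<or>
        (\<exists>p' s'. \<beta> = ear n m p' s' \<and> 2 \<le> s' - p' \<and> s' - p' \<le> int n \<and>
          (\<forall>i. p' < i \<and> i < s' \<longrightarrow> \<not> int n dvd i - p))"
    have "compatible n m (spiral_arc n m p) \<beta>" if "\<beta> \<in> T" for \<beta>
      using *[OF that]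
    proof (elim disjE exE conjE)
      assume "\<forall>i. num_ends (outer_point n (of_int i)) \<beta> = 0"
      then show ?thesis using compatible_spiral_arc[OF n T_arcs[OF that]] by blast
    next
      fix p' s' assume **: "\<beta> = ear n m p' s'" "2 \<le> s' - p'" "s' - p' \<le> int n"
        "\<forall>i. p' < i \<and> i < s' \<longrightarrow> \<not> int n dvd i - p"
      have "compatible n m (ear n m p' s') (spiral_arc n m p)"
        by (rule compatible_ear[OF **(2,3) spiral_arc_in_arcs[OF n]])
          (use **(4) in \<open>simp add: num_ends_spiral_arc[OF n]\<close>)
      then show ?thesis using **(1) compatible_sym by blast
    qed
    then have "spiral_arc n m p \<in> T"
      by (intro maximal spiral_arc_in_arcs[OF n])
    moreover have "num_ends (outer_point n (of_int p)) (spiral_arc n m p) \<noteq> 0"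
      by (simp add: num_ends_spiral_arc[OF n])
    moreover have "spiral_arc n m p \<noteq> ear n m p' s'" for p' s'
      unfolding spiral_arc_def ear_def by simp
    ultimately show "\<exists>\<beta>\<in>T. num_ends (outer_point n (of_int p)) \<beta> \<noteq> 0 \<and>
        (\<forall>p' s'. 2 \<le> s' - p' \<and> s' - p' \<le> int n \<longrightarrow> \<beta> \<noteq> ear n m p' s')"
      by blast
  qed (use num_ends_ear ear_eqD in blast)+
qed

theorem theorem3p7:
  fixes n m :: nat and T :: "annulus_arc set" and a :: "nat \<Rightarrow> nat"
  assumes "n \<ge> 1"
    and "annulus_triangulation n m T"
    and "outer_quiddity_sequence n m T a"
  shows "\<exists>F. infinite_frieze F \<and> (\<forall>i. quiddity_row F i = periodic_extension n a i)"
proof -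
  interpret ear_system n T "\<lambda>i. num_ends (outer_point n (of_int i))" "ear n m"
    by (rule ear_system_triangulation[OF assms])
  have "int (num_triangles T i) = periodic_extension n a i" for i
  proof -
    define k where "k = nat ((i - 1) mod int n) + 1"
    have "0 \<le> (i - 1) mod int n" "(i - 1) mod int n < int n" using assms(1) by simp_all
    then have "k \<in> {1..n}" unfolding k_def by auto
    moreover from this have "marked_point n m k = outer_point n (of_int i)"
      using outer_point_int_eq_nat[OF assms(1), of i]
      by (simp only: marked_point_outer atLeastAtMost_iff k_def)
    ultimately have "a k = num_triangles T i"
      using assms(3) unfolding outer_quiddity_sequence_def num_triangles_def Let_def by metis
    then show ?thesis unfolding periodic_extension_def k_def by simp
  qed
  then show ?thesis using infinite_frieze_num_triangles by simp
qed

end
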